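(* Let $m\ge 0$ be an integer and let $\lambda,\delta,\rho$ be three proper $m$-marked cycle shapes. For natural numbers $n\geq m$ with $n\geq |\lambda|,|\delta|,|\rho|$, consider the structure coefficient $c_{\underline{\lambda}_n,\underline{\delta}_n}^{\underline{\rho}_n}(n)$ of the $m$-centraliser algebra $Z_{n,m}$, which is a polynomial in $n$. Its degree satisfies $$\deg\left(c_{\underline{\lambda}_n,\underline{\delta}_n}^{\underline{\rho}_n}(n)\right)\leq \frac{|\lambda|+|\delta|-|\rho|}{2}.$$
   Context: Notation: $[n]=\{1,\dots,n\}$, $[0]=\emptyset$; $\mathcal{S}_n$ is the group of permutations of $[n]$, with product given by composition. For $0\le m\le n$, $Stab_n(m)$ is the subgroup of $\mathcal{S}_n$ of permutations fixing every element of $[m]$. Marked cycle shapes: let $\ast$ be a formal symbol. An $m$-marked cycle shape is a finite collection (multiset) of cycles (nonempty words up to cyclic rotation) with entries in $[m]\cup\{\ast\}$ such that each element of $[m]$ appears exactly once in total and $\ast$ appears $r$ times in total for some integer $r\ge 0$. Its size is $|\rho|=m+r$, and $m_1(\rho)$ is the number of cycles of $\rho$ equal to $(\ast)$ (cycles $(a)$ with $a\in[m]$ are not counted). $\rho$ is proper if $m_1(\rho)=0$. $\mathcal{P}^m_n$ is the set of $m$-marked cycle shapes of size $n$. For $n\ge|\rho|$, $\underline{\rho}_n\in\mathcal{P}^m_n$ is the shape obtained from $\rho$ by adding $n-|\rho|$ cycles $(\ast)$. The $m$-marked cycle type of a permutation of $[n]$ is the shape in $\mathcal{P}^m_n$ obtained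 from its full cycle notation (fixed points included) by replacing each element of $[n]\setminus[m]$ by $\ast$. The $m$-centraliser algebra: $Z_{n,m}=\{z\in\mathbb{Z}[\mathcal{S}_n]: \tau z=z\tau \text{ for all }\tau\in Stab_n(m)\}$. For $\lambda\in\mathcal{P}^m_n$, let $K_\lambda$ be the sum of all permutations of $[n]$ with $m$-marked cycle type $\lambda$. The $K_\lambda$, $\lambda\in\mathcal{P}^m_n$, form a $\mathbb{Z}$-basis of $Z_{n,m}$, and the structure coefficients $c_{\lambda,\delta}^{\rho}(n)$ (for $\lambda,\delta,\rho\in\mathcal{P}^m_n$) are defined by $K_\lambda K_\delta=\sum_{\rho\in\mathcal{P}^m_n}c_{\lambda,\delta}^\rho(n)K_\rho$. Degree: for fixed proper $\lambda,\delta,\rho$, there is a unique polynomial $p\in\mathbb{Q}[x]$ such that $c_{\underline{\lambda}_n,\underline{\delta}_n}^{\underline{\rho}_n}(n)=p(n)$ for all integers $n\ge\max(|\lambda|,|\delta|,|\rho|)$; $\deg(c_{\underline{\lambda}_n,\underline{\delta}_n}^{\underline{\rho}_n}(n))$ means $\deg p$, with the convention that the zero polynomial has degree $-\infty$. *)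

theory Defs
  imports
    "HOL-Algebra.Sym_Groups"
    "HOL-Algebra.Ring"
    "HOL-Library.Multiset"
    "HOL-Library.Extended_Real"
    "HOL-Computational_Algebra.Polynomial"
begin

section \<open>Cyclic words\<close>

definition rotation_of :: "'a list \<Rightarrow> 'a list \<Rightarrow> bool" where
  "rotation_of u v \<longleftrightarrow> u \<noteq> [] \<and> (\<exists>k. v = rotate k u)"

lemma rotation_of_sym: "rotation_of u v \<Longrightarrow> rotation_of v u"
proof -
  assume "rotation_of u v"
  then obtain k where u: "u \<noteq> []" and v: "v = rotate k u"
    by (auto simp: rotation_of_def)
  have "rotate (length u - k mod length u) v =
      rotate (length u - k mod length u + k mod length u) u"
    unfolding v by (metis rotate_conv_mod rotate_rotate)
  also have "\<dots> = u"
    using u by (simp add: mod_le_divisor)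
  finally have "rotate (length u - k mod length u) v = u" .
  then show ?thesis
    using u v by (metis rotation_of_def rotate_is_Nil_conv)
qed

lemma part_equivp_rotation_of: "part_equivp rotation_of"
proof (rule part_equivpI)
  show "\<exists>x::'a list. rotation_of x x"
    by (rule exI[of _ "[undefined]"]) (auto simp: rotation_of_def intro: exI[of _ 0])
  show "symp (rotation_of :: 'a list \<Rightarrow> _)"
    by (auto intro!: sympI rotation_of_sym)
  show "transp (rotation_of :: 'a list \<Rightarrow> _)"
    by (rule transpI) (auto simp: rotation_of_def rotate_rotate)
qed

lemma mset_rotate: "mset (rotate k u) = mset u"
proof (induction k)
  case (Suc k)
  have "mset (rotate1 v) = mset v" for v :: "'a list"
    by (cases v) auto
  with Suc show ?case by simp
qed simp

text \<open>Nonempty words up to rotation; \<^term>\<open>abs_cyclic_word w\<close> is meaningful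
  only for \<^prop>\<open>w \<noteq> []\<close>.\<close>

quotient_type 'a cyclic_word = "'a list" / partial: rotation_of
  by (rule part_equivp_rotation_of)

lift_definition letters :: "'a cyclic_word \<Rightarrow> 'a multiset" is mset
  by (auto simp: rotation_of_def mset_rotate)

lift_definition map_cyclic_word :: "('a \<Rightarrow> 'b) \<Rightarrow> 'a cyclic_word \<Rightarrow> 'b cyclic_word" is map
  by (auto simp: rotation_of_def rotate_map)


section \<open>Marked cycle shapes\<close>

datatype mark = Elt nat | Star

type_synonym shape = "mark cyclic_word multiset"

definition shape_letters :: "shape \<Rightarrow> mark multiset" where
  "shape_letters \<rho> = \<Sum>\<^sub># (image_mset letters \<rho>)"

definition marked_cycle_shape :: "nat \<Rightarrow> shape \<Rightarrow> bool" where
  "marked_cycle_shape m \<rho> \<longleftrightarrow>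
     set_mset (shape_letters \<rho>) \<subseteq> insert Star (Elt ` {1..m}) \<and>
     (\<forall>a\<in>{1..m}. count (shape_letters \<rho>) (Elt a) = 1)"

definition shape_size :: "nat \<Rightarrow> shape \<Rightarrow> nat" where
  "shape_size m \<rho> = m + count (shape_letters \<rho>) Star"

abbreviation star_cycle :: "mark cyclic_word" where
  "star_cycle \<equiv> abs_cyclic_word [Star]"

definition m1 :: "shape \<Rightarrow> nat" where
  "m1 \<rho> = count \<rho> star_cycle"

definition proper_shape :: "shape \<Rightarrow> bool" where
  "proper_shape \<rho> \<longleftrightarrow> m1 \<rho> = 0"

definition marked_shapes :: "nat \<Rightarrow> nat \<Rightarrow> shape set" where
  "marked_shapes m n = {\<rho>. marked_cycle_shape m \<rho> \<and> shape_size m \<rho> = n}"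

definition pad_shape :: "nat \<Rightarrow> nat \<Rightarrow> shape \<Rightarrow> shape" where
  "pad_shape m n \<rho> = \<rho> + replicate_mset (n - shape_size m \<rho>) star_cycle"


section \<open>Marked cycle types\<close>

text \<open>\<^term>\<open>support \<sigma> x\<close> is the word $x, \sigma(x), \sigma^2(x), \ldots$ running once
  through the cycle of \<open>x\<close>; it is \<open>[x]\<close> at a fixed point. Different points of
  one cycle give the same cyclic word, so forming the set of these counts each cycle once.\<close>

definition perm_cycles :: "nat \<Rightarrow> (nat \<Rightarrow> nat) \<Rightarrow> nat cyclic_word set" where
  "perm_cycles n \<sigma> = (\<lambda>x. abs_cyclic_word (support \<sigma> x)) ` {1..n}"

definition mark_of :: "nat \<Rightarrow> nat \<Rightarrow> mark" where
  "mark_of m x = (if x \<in> {1..m} then Elt x else Star)"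

definition marked_cycle_type :: "nat \<Rightarrow> nat \<Rightarrow> (nat \<Rightarrow> nat) \<Rightarrow> shape" where
  "marked_cycle_type m n \<sigma> =
     image_mset (map_cyclic_word (mark_of m)) (mset_set (perm_cycles n \<sigma>))"


section \<open>The centraliser algebra and its structure coefficients\<close>

text \<open>The integral group ring of \<^term>\<open>sym_group n\<close>, as coefficient functions on permutations.\<close>

definition sym_group_ring :: "nat \<Rightarrow> ((nat \<Rightarrow> nat) \<Rightarrow> int) ring" where
  "sym_group_ring n =
    \<lparr> carrier = {f. \<forall>\<pi>. \<pi> \<notin> carrier (sym_group n) \<longrightarrow> f \<pi> = 0},
      mult = (\<lambda>f g \<pi>. \<Sum>(\<sigma>, \<tau>) | \<sigma> \<in> carrier (sym_group n) \<and> \<tau> \<in> carrier (sym_group n)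
                           \<and> \<sigma> \<otimes>\<^bsub>sym_group n\<^esub> \<tau> = \<pi>. f \<sigma> * g \<tau>),
      one = (\<lambda>\<pi>. of_bool (\<pi> = id)),
      zero = (\<lambda>\<pi>. 0),
      add = (\<lambda>f g \<pi>. f \<pi> + g \<pi>) \<rparr>"

definition perm_elem :: "(nat \<Rightarrow> nat) \<Rightarrow> (nat \<Rightarrow> nat) \<Rightarrow> int" where
  "perm_elem \<sigma> = (\<lambda>\<pi>. of_bool (\<pi> = \<sigma>))"

definition Stab :: "nat \<Rightarrow> nat \<Rightarrow> (nat \<Rightarrow> nat) set" where
  "Stab n m = {\<tau> \<in> carrier (sym_group n). \<forall>a\<in>{1..m}. \<tau> a = a}"

definition centraliser_algebra :: "nat \<Rightarrow> nat \<Rightarrow> ((nat \<Rightarrow> nat) \<Rightarrow> int) ring" where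
  "centraliser_algebra n m = (sym_group_ring n)
    \<lparr> carrier := {z \<in> carrier (sym_group_ring n). \<forall>\<tau>\<in>Stab n m.
        perm_elem \<tau> \<otimes>\<^bsub>sym_group_ring n\<^esub> z = z \<otimes>\<^bsub>sym_group_ring n\<^esub> perm_elem \<tau>} \<rparr>"

definition class_sum :: "nat \<Rightarrow> nat \<Rightarrow> shape \<Rightarrow> (nat \<Rightarrow> nat) \<Rightarrow> int" where
  "class_sum m n lam = (\<lambda>\<pi>. \<Sum>\<sigma> | \<sigma> \<in> carrier (sym_group n) \<and> marked_cycle_type m n \<sigma> = lam.
     perm_elem \<sigma> \<pi>)"

text \<open>The coordinates of a product in the basis \<^term>\<open>class_sum m n \<rho>\<close>,
  \<^prop>\<open>\<rho> \<in> marked_shapes m n\<close>; requiring the value \<open>0\<close> at all other shapes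
  makes the coordinate function unique.\<close>

definition structure_coeff :: "nat \<Rightarrow> nat \<Rightarrow> shape \<Rightarrow> shape \<Rightarrow> shape \<Rightarrow> int" where
  "structure_coeff m n lam \<delta> = (THE c.
     (\<forall>\<rho>. \<rho> \<notin> marked_shapes m n \<longrightarrow> c \<rho> = 0) \<and>
     class_sum m n lam \<otimes>\<^bsub>centraliser_algebra n m\<^esub> class_sum m n \<delta> =
       (\<lambda>\<pi>. \<Sum>\<rho>\<in>marked_shapes m n. c \<rho> * class_sum m n \<rho> \<pi>))"


section \<open>The structure coefficients as polynomials\<close>

definition is_structure_poly :: "nat \<Rightarrow> shape \<Rightarrow> shape \<Rightarrow> shape \<Rightarrow> rat poly \<Rightarrow> bool" where
  "is_structure_poly m lam \<delta> \<rho> p \<longleftrightarrow>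
     (\<forall>n. n \<ge> m \<and> n \<ge> shape_size m lam \<and> n \<ge> shape_size m \<delta> \<and> n \<ge> shape_size m \<rho> \<longrightarrow>
        of_int (structure_coeff m n (pad_shape m n lam) (pad_shape m n \<delta>) (pad_shape m n \<rho>))
          = poly p (of_nat n))"

definition structure_poly :: "nat \<Rightarrow> shape \<Rightarrow> shape \<Rightarrow> shape \<Rightarrow> rat poly" where
  "structure_poly m lam \<delta> \<rho> = (THE p. is_structure_poly m lam \<delta> \<rho> p)"

definition poly_deg :: "rat poly \<Rightarrow> ereal" where
  "poly_deg p = (if p = 0 then - \<infinity> else ereal (real (degree p)))"

end

theory Submission
  imports Defs
begin

text \<open>
  Marked cycle types are the orbits of the stabiliser acting by conjugation, so
  \<open>c\<^sub>\<lambda>\<^sub>\<delta>\<^sup>\<rho>(n)\<close> counts the factorisations \<open>\<sigma> \<circ> \<tau> = \<pi>\<close> of any fixed \<open>\<pi>\<close> of type \<open>\<rho>\<close>. Choose \<open>\<pi>\<close> to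
  permute \<open>{1..r}\<close> with \<open>r = |\<rho>|\<close>; since \<open>\<rho>\<close> is proper, \<open>{1..r}\<close> is exactly \<open>{1..m}\<close> together with the
  points moved by \<open>\<pi>\<close>. Let \<open>B\<close> be the set of points outside \<open>{1..r}\<close> moved by \<open>\<sigma>\<close>; these are also the
  ones moved by \<open>\<tau>\<close>, because \<open>\<pi>\<close> fixes them. Conjugation by permutations fixing \<open>{1..r}\<close> shows that
  the number \<open>N\<^sub>j\<close> of factorisations with a given \<open>B\<close> depends only on \<open>j = card B\<close>, whence
  \<open>c\<^sub>\<lambda>\<^sub>\<delta>\<^sup>\<rho>(n) = (\<Sum>j. ((n - r) choose j) * N\<^sub>j)\<close>, a polynomial in \<open>n\<close>.

  For the degree, put \<open>S(\<sigma>) = {1..m} \<union> {x. \<sigma> x \<noteq> x}\<close>, a set with \<open>|\<lambda>|\<close> elements, and likewise \<open>S(\<tau>)\<close>.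
  Their union contains \<open>{1..r} \<union> B\<close> and their intersection contains \<open>B\<close>, so
  \<open>|\<lambda>| + |\<delta>| \<ge> r + 2 * j\<close> whenever \<open>N\<^sub>j \<noteq> 0\<close>.
\<close>

section \<open>Cycles of permutations as cyclic words\<close>

abbreviation cyc :: "('a \<Rightarrow> 'a) \<Rightarrow> 'a \<Rightarrow> 'a cyclic_word" where
  "cyc \<sigma> x \<equiv> abs_cyclic_word (support \<sigma> x)"

lemma rotation_of_refl: "u \<noteq> [] \<Longrightarrow> rotation_of u u"
  unfolding rotation_of_def by (metis rotate0 id_apply)

lemma abs_cyclic_word_eq_iff:
  assumes "u \<noteq> []" "v \<noteq> []"
  shows "abs_cyclic_word u = abs_cyclic_word v \<longleftrightarrow> (\<exists>k. v = rotate k u)"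
  using Quotient3_rel[OF Quotient3_cyclic_word, of u v] assms
  by (auto simp: rotation_of_refl) (auto simp: rotation_of_def)

lemma letters_abs: "u \<noteq> [] \<Longrightarrow> letters (abs_cyclic_word u) = mset u"
  by (rule letters.abs_eq) (simp add: rotation_of_refl)

lemma map_cyclic_word_abs:
  "u \<noteq> [] \<Longrightarrow> map_cyclic_word f (abs_cyclic_word u) = abs_cyclic_word (map f u)"
  by (rule map_cyclic_word.abs_eq) (simp add: rotation_of_refl)

lemma cyclic_word_exhaust:
  obtains u where "u \<noteq> []" "c = abs_cyclic_word u"
  using Quotient3_rep_abs Quotient3_cyclic_word
  by (metis Quotient3_def rotation_of_def)

lemma letters_map_cyclic_word:
  "letters (map_cyclic_word f c) = image_mset f (letters c)"
  by (cases c rule: cyclic_word_exhaust) (simp add: letters_abs map_cyclic_word_abs)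

lemma map_cyclic_word_comp:
  "map_cyclic_word f (map_cyclic_word g c) = map_cyclic_word (f \<circ> g) c"
  by (cases c rule: cyclic_word_exhaust) (simp add: map_cyclic_word_abs)

lemma map_cyclic_word_id: "map_cyclic_word id c = c"
  by (cases c rule: cyclic_word_exhaust) (simp add: map_cyclic_word_abs)

lemma inj_map_cyclic_word:
  assumes "inj f" shows "inj (map_cyclic_word f)"
  by (rule inj_on_inverseI[where g = "map_cyclic_word (inv' f)"])
    (simp add: map_cyclic_word_comp assms map_cyclic_word_id)

section \<open>Orbits of a single permutation and their cyclic words\<close>

context
  fixes \<sigma> :: "'a \<Rightarrow> 'a"
  assumes perm: "permutation \<sigma>"
begin

lemma support_nonempty: "support \<sigma> x \<noteq> []"
  using least_power_of_permutation(2)[OF perm, of x] by simp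

text \<open>Cancelling the injective power \<open>\<sigma> ^^ i\<close> turns the equation into a
  return to \<open>x\<close> after \<open>j - i\<close> steps, so only divisibility by the cycle
  length matters.\<close>

lemma funpow_eq_iff_cong:
  "(\<sigma> ^^ i) x = (\<sigma> ^^ j) x \<longleftrightarrow> i mod least_power \<sigma> x = j mod least_power \<sigma> x"
proof -
  have *: "(\<sigma> ^^ i) x = (\<sigma> ^^ j) x \<longleftrightarrow> i mod least_power \<sigma> x = j mod least_power \<sigma> x"
    if "i \<le> j" for i j
  proof -
    have "inj (\<sigma> ^^ i)" using perm by (intro inj_fn bij_is_inj permutation_bijective)
    moreover have "(\<sigma> ^^ j) x = (\<sigma> ^^ i) ((\<sigma> ^^ (j - i)) x)"
      using that by (metis funpow_add le_add_diff_inverse o_apply)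
    ultimately have "(\<sigma> ^^ i) x = (\<sigma> ^^ j) x \<longleftrightarrow> (\<sigma> ^^ (j - i)) x = x"
      by (metis injD)
    also have "\<dots> \<longleftrightarrow> least_power \<sigma> x dvd j - i"
      by (simp add: least_power_dvd[OF perm])
    also have "\<dots> \<longleftrightarrow> i mod least_power \<sigma> x = j mod least_power \<sigma> x"
      using that by (metis mod_eq_dvd_iff_nat)
    finally show ?thesis .
  qed
  show ?thesis
    using *[of i j] *[of j i] by (metis nat_le_linear)
qed

lemma least_power_funpow: "least_power \<sigma> ((\<sigma> ^^ k) x) = least_power \<sigma> x"
proof -
  have inj: "inj (\<sigma> ^^ k)" using perm by (intro inj_fn bij_is_inj permutation_bijective)
  have "(\<sigma> ^^ n) ((\<sigma> ^^ k) x) = (\<sigma> ^^ k) ((\<sigma> ^^ n) x)" for n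
    by (metis add.commute funpow_add o_apply)
  with inj have "(\<sigma> ^^ n) ((\<sigma> ^^ k) x) = (\<sigma> ^^ k) x \<longleftrightarrow> (\<sigma> ^^ n) x = x" for n
    by (metis injD)
  then show ?thesis unfolding least_power_def by simp
qed

text \<open>Reducing the exponent \<open>k + i\<close> modulo the cycle length is exactly how
  \<open>rotate\<close> indexes. Hence \<open>cyc\<close> does not depend on the starting point in a
  cycle.\<close>

lemma support_funpow: "support \<sigma> ((\<sigma> ^^ k) x) = rotate k (support \<sigma> x)"
proof (rule nth_equalityI)
  show "length (support \<sigma> ((\<sigma> ^^ k) x)) = length (rotate k (support \<sigma> x))"
    by (simp add: least_power_funpow)
next
  fix i assume "i < length (support \<sigma> ((\<sigma> ^^ k) x))"
  then have i: "i < least_power \<sigma> x" by (simp add: least_power_funpow)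
  have "support \<sigma> ((\<sigma> ^^ k) x) ! i = (\<sigma> ^^ (k + i)) x"
    using i by (simp add: least_power_funpow) (metis add.commute funpow_add o_apply)
  also have "\<dots> = (\<sigma> ^^ ((k + i) mod least_power \<sigma> x)) x"
    by (simp add: funpow_eq_iff_cong)
  also have "\<dots> = rotate k (support \<sigma> x) ! i"
    using i by (subst nth_rotate) auto
  finally show "support \<sigma> ((\<sigma> ^^ k) x) ! i = rotate k (support \<sigma> x) ! i" .
qed

lemma cyc_eq_iff: "cyc \<sigma> x = cyc \<sigma> y \<longleftrightarrow> (\<exists>k. y = (\<sigma> ^^ k) x)"
proof
  assume "\<exists>k. y = (\<sigma> ^^ k) x"
  then obtain k where "y = (\<sigma> ^^ k) x" ..
  then show "cyc \<sigma> x = cyc \<sigma> y"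
    using support_nonempty by (auto simp: abs_cyclic_word_eq_iff support_funpow)
next
  \<comment> \<open>Equal cyclic words have the same letters, so the two orbits coincide, and
    \<open>y\<close> lies in its own.\<close>
  assume "cyc \<sigma> x = cyc \<sigma> y"
  then have "mset (support \<sigma> x) = mset (support \<sigma> y)"
    using letters_abs support_nonempty by metis
  then have "set (support \<sigma> x) = set (support \<sigma> y)" by (rule mset_eq_setD)
  then have "range (\<lambda>i. (\<sigma> ^^ i) x) = range (\<lambda>i. (\<sigma> ^^ i) y)"
    by (simp only: support_set[OF perm])
  moreover have "y \<in> range (\<lambda>i. (\<sigma> ^^ i) y)" by (rule range_eqI[of _ _ 0]) simp
  ultimately have "y \<in> range (\<lambda>i. (\<sigma> ^^ i) x)" by simp
  then show "\<exists>k. y = (\<sigma> ^^ k) x" by blast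
qed

lemma funpow_in_invariant:
  assumes "\<sigma> ` A \<subseteq> A" "x \<in> A" shows "(\<sigma> ^^ k) x \<in> A"
  using assms by (induction k) auto

lemma letters_cyc:
  assumes "\<sigma> ` A \<subseteq> A" "finite A" "x \<in> A"
  shows "letters (cyc \<sigma> x) = mset_set {y \<in> A. cyc \<sigma> y = cyc \<sigma> x}"
proof -
  have "letters (cyc \<sigma> x) = mset (support \<sigma> x)"
    by (rule letters_abs[OF support_nonempty])
  also have "\<dots> = mset_set (set (support \<sigma> x))"
    by (metis cycle_of_permutation mset_set_set perm)
  also have "set (support \<sigma> x) = {y \<in> A. cyc \<sigma> y = cyc \<sigma> x}"
  proof -
    have "cyc \<sigma> y = cyc \<sigma> x \<longleftrightarrow> y \<in> range (\<lambda>i. (\<sigma> ^^ i) x)" for y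
      using cyc_eq_iff[of x y] by auto
    then show ?thesis
      unfolding support_set[OF perm] using funpow_in_invariant[OF assms(1,3)] by blast
  qed
  finally show ?thesis .
qed

text \<open>The fibres of \<open>cyc \<sigma>\<close> partition \<open>A\<close> into cycles, and
  each cyclic word lists its fibre without repetition.\<close>

lemma sum_letters_cyc:
  assumes "\<sigma> ` A \<subseteq> A" "finite A"
  shows "(\<Sum>c\<in>cyc \<sigma> ` A. letters c) = mset_set A"
proof -
  have "(\<Sum>c\<in>cyc \<sigma> ` A. letters c) = (\<Sum>c\<in>cyc \<sigma> ` A. \<Sum>x\<in>{x \<in> A. cyc \<sigma> x = c}. {#x#})"
    using assms by (intro sum.cong) (auto simp: letters_cyc)
  also have "\<dots> = (\<Sum>x\<in>A. {#x#})"
    using assms(2) by (rule sum.image_gen[symmetric])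
  finally show ?thesis by simp
qed

end

section \<open>Shapes of invariant sets\<close>

text \<open>A general set \<open>A\<close> in place of \<open>{1..n}\<close> allows a cycle type to
  be cut into the part on the core and the part on the other fixed points. The set of cycles is
  formed before marking, so distinct cycles with equal marked words keep their multiplicity.\<close>

definition shape_of :: "nat \<Rightarrow> (nat \<Rightarrow> nat) \<Rightarrow> nat set \<Rightarrow> shape" where
  "shape_of m \<sigma> A = image_mset (map_cyclic_word (mark_of m)) (mset_set (cyc \<sigma> ` A))"

text \<open>The points that remain when all cycles \<open>(\<star>)\<close> are removed from a marked cycle type.\<close>

definition core :: "nat \<Rightarrow> (nat \<Rightarrow> nat) \<Rightarrow> nat set" where
  "core m \<sigma> = {1..m} \<union> {x. \<sigma> x \<noteq> x}"

lemma marked_cycle_type_eq: "marked_cycle_type m n \<sigma> = shape_of m \<sigma> {1..n}"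
  by (simp add: marked_cycle_type_def shape_of_def perm_cycles_def)

lemma image_mset_sum:
  "finite C \<Longrightarrow> image_mset f (sum g C) = (\<Sum>c\<in>C. image_mset f (g c))"
  by (induction C rule: finite_induct) auto

lemma shape_letters_shape_of:
  assumes "permutation \<sigma>" "\<sigma> ` A \<subseteq> A" "finite A"
  shows "shape_letters (shape_of m \<sigma> A) = image_mset (mark_of m) (mset_set A)"
proof -
  have "shape_letters (shape_of m \<sigma> A) = (\<Sum>c\<in>cyc \<sigma> ` A. image_mset (mark_of m) (letters c))"
    by (simp add: shape_letters_def shape_of_def sum_unfold_sum_mset multiset.map_comp comp_def
        letters_map_cyclic_word)
  also have "\<dots> = image_mset (mark_of m) (\<Sum>c\<in>cyc \<sigma> ` A. letters c)"
    using assms(3) by (simp add: image_mset_sum)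
  finally show ?thesis using assms by (simp add: sum_letters_cyc)
qed

text \<open>The intertwining relation passes to all powers, so \<open>\<theta>\<close> carries the
  orbit word of \<open>x\<close> to that of \<open>\<theta> x\<close> letter by letter.\<close>

lemma cyc_conj:
  assumes "permutation \<sigma>" "bij \<theta>" "\<tau> \<circ> \<theta> = \<theta> \<circ> \<sigma>"
  shows "cyc \<tau> (\<theta> x) = map_cyclic_word \<theta> (cyc \<sigma> x)"
proof -
  have *: "(\<tau> ^^ i) (\<theta> x) = \<theta> ((\<sigma> ^^ i) x)" for i
    using assms(3) by (induction i) (auto simp: fun_eq_iff)
  have "least_power \<tau> (\<theta> x) = least_power \<sigma> x"
    unfolding least_power_def using assms(2) by (simp add: * bij_is_inj inj_eq)
  then have "support \<tau> (\<theta> x) = map \<theta> (support \<sigma> x)" by (simp add: *)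
  then show ?thesis
    by (metis map_cyclic_word_abs support_nonempty[OF assms(1)])
qed

text \<open>Injectivity keeps points outside \<open>{1..m}\<close> outside, because every point of
  \<open>{1..m}\<close> is already the image of itself.\<close>

lemma mark_of_comp:
  assumes "inj \<theta>" "\<And>a. a \<in> {1..m} \<Longrightarrow> \<theta> a = a"
  shows "mark_of m \<circ> \<theta> = mark_of m"
proof
  fix x
  show "(mark_of m \<circ> \<theta>) x = mark_of m x"
  proof (cases "x \<in> {1..m}")
    case False
    then have "\<theta> x \<notin> {1..m}" using assms by (metis injD)
    with False show ?thesis by (auto simp: mark_of_def)
  qed (use assms in \<open>simp add: mark_of_def\<close>)
qed

lemma shape_of_conj:
  assumes "permutation \<sigma>" "bij \<theta>" "\<And>a. a \<in> {1..m} \<Longrightarrow> \<theta> a = a" "\<tau> \<circ> \<theta> = \<theta> \<circ> \<sigma>"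
  shows "shape_of m \<tau> (\<theta> ` A) = shape_of m \<sigma> A"
proof -
  have inj: "inj \<theta>" using assms(2) by (rule bij_is_inj)
  have "cyc \<tau> ` \<theta> ` A = map_cyclic_word \<theta> ` cyc \<sigma> ` A"
    using cyc_conj[OF assms(1,2,4)] by (simp add: image_image)
  \<comment> \<open>Distinct cycles stay distinct under \<open>\<theta>\<close>, so no multiplicity
    is lost.\<close>
  moreover have "inj_on (map_cyclic_word \<theta>) (cyc \<sigma> ` A)"
    using inj_map_cyclic_word[OF inj] by (rule inj_on_subset) simp
  ultimately show ?thesis
    using mark_of_comp[OF inj assms(3)]
    by (simp add: shape_of_def image_mset_mset_set[symmetric] multiset.map_comp comp_def
        map_cyclic_word_comp[unfolded comp_def])
qed

lemma core_conj:
  assumes "bij \<theta>" "\<And>a. a \<in> {1..m} \<Longrightarrow> \<theta> a = a" "\<tau> \<circ> \<theta> = \<theta> \<circ> \<sigma>"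
  shows "core m \<tau> = \<theta> ` core m \<sigma>"
proof -
  have *: "\<tau> (\<theta> x) = \<theta> (\<sigma> x)" for x using assms(3) by (simp add: fun_eq_iff)
  have "\<theta> ` {1..m} = {1..m}" using assms(2) by auto
  moreover have "{x. \<tau> x \<noteq> x} = \<theta> ` {x. \<sigma> x \<noteq> x}"
  proof (intro Set.equalityI subsetI)
    fix y assume "y \<in> {x. \<tau> x \<noteq> x}"
    moreover obtain x where "y = \<theta> x" using assms(1) by (metis bij_pointE)
    ultimately show "y \<in> \<theta> ` {x. \<sigma> x \<noteq> x}" by (auto simp: *)
  qed (use assms(1) in \<open>auto simp: * bij_is_inj inj_eq\<close>)
  ultimately show ?thesis by (simp add: core_def image_Un)
qed

section \<open>Splitting a permutation into its core and the remaining fixed points\<close>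

lemma finite_core: "permutation \<sigma> \<Longrightarrow> finite (core m \<sigma>)"
  by (simp add: core_def permutation)

lemma core_invariant:
  assumes "inj \<sigma>" shows "\<sigma> ` core m \<sigma> \<subseteq> core m \<sigma>"
  using assms by (auto simp: core_def inj_eq)

text \<open>Invariance of \<open>A\<close> prevents a cycle from meeting both sets, so the two sets
  of cyclic words are disjoint and their multisets add.\<close>

lemma shape_of_Un:
  assumes "permutation \<sigma>" "\<sigma> ` A \<subseteq> A" "finite A" "finite B" "A \<inter> B = {}"
  shows "shape_of m \<sigma> (A \<union> B) = shape_of m \<sigma> A + shape_of m \<sigma> B"
proof -
  have "cyc \<sigma> ` A \<inter> cyc \<sigma> ` B = {}"
    using assms(5) funpow_in_invariant[OF assms(1,2)]
    by (fastforce simp: cyc_eq_iff[OF assms(1)])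
  then show ?thesis
    using assms by (simp add: shape_of_def image_Un mset_set_Union)
qed

lemma cyc_fixed: "\<sigma> x = x \<Longrightarrow> cyc \<sigma> x = abs_cyclic_word [x]"
proof -
  assume x: "\<sigma> x = x"
  then have "(\<sigma> ^^ 1) x = x" by simp
  then have "least_power \<sigma> x = 1"
    using least_power_le[of 1 \<sigma> x] least_powerI(2)[of 1 \<sigma> x] by simp
  then show ?thesis by simp
qed

lemma shape_of_fixed:
  assumes "\<And>x. x \<in> B \<Longrightarrow> \<sigma> x = x" "B \<inter> {1..m} = {}" "finite B"
  shows "shape_of m \<sigma> B = replicate_mset (card B) star_cycle"
proof -
  have "cyc \<sigma> ` B = (\<lambda>x. abs_cyclic_word [x]) ` B"
    using assms(1) by (intro image_cong) (simp_all add: cyc_fixed)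
  moreover have "inj_on (\<lambda>x. abs_cyclic_word [x]) B"
    by (auto simp: inj_on_def abs_cyclic_word_eq_iff)
  ultimately have "shape_of m \<sigma> B =
      image_mset (\<lambda>x. map_cyclic_word (mark_of m) (abs_cyclic_word [x])) (mset_set B)"
    by (simp add: shape_of_def image_mset_mset_set[symmetric] multiset.map_comp comp_def)
  also have "\<dots> = image_mset (\<lambda>x. star_cycle) (mset_set B)"
    using assms(2,3) by (intro image_mset_cong) (auto simp: map_cyclic_word_abs mark_of_def)
  finally show ?thesis by (simp add: image_mset_const_eq)
qed

text \<open>A cycle marked \<open>star_cycle\<close> has length one, so its point is fixed; but a
  fixed point of the core lies in \<open>{1..m}\<close> and is marked \<open>Elt\<close>.\<close>

lemma star_notin_core:
  assumes "permutation \<sigma>"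
  shows "star_cycle \<notin># shape_of m \<sigma> (core m \<sigma>)"
proof
  assume "star_cycle \<in># shape_of m \<sigma> (core m \<sigma>)"
  then obtain x where x: "x \<in> core m \<sigma>" "star_cycle = map_cyclic_word (mark_of m) (cyc \<sigma> x)"
    using finite_core[OF assms] by (auto simp: shape_of_def)
  have "letters star_cycle = image_mset (mark_of m) (mset (support \<sigma> x))"
    unfolding x(2) letters_map_cyclic_word by (simp only: letters_abs[OF support_nonempty[OF assms]])
  moreover have "letters star_cycle = {#Star#}" by (simp add: letters_abs)
  ultimately have *: "{#Star#} = mset (map (mark_of m) (support \<sigma> x))" by (simp only: mset_map)
  then have "map (mark_of m) (support \<sigma> x) = [Star]" by (metis mset_single_iff_right)
  then have "length (support \<sigma> x) = 1" by (metis length_map length_Cons list.size(3) One_nat_def)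
  then have len: "least_power \<sigma> x = 1" by simp
  with least_power_of_permutation(1)[OF assms, of x] have "\<sigma> x = x" by simp
  with x(1) have "x \<in> {1..m}" by (simp add: core_def)
  moreover have "mark_of m x = Star" using * len by simp
  ultimately show False by (simp add: mark_of_def)
qed

lemma image_mark_of:
  assumes "finite A" "{1..m} \<subseteq> A"
  shows "image_mset (mark_of m) (mset_set A) =
    mset_set (Elt ` {1..m}) + replicate_mset (card A - m) Star"
proof -
  have "image_mset (mark_of m) (mset_set {1..m}) = image_mset Elt (mset_set {1..m})"
    by (intro image_mset_cong) (auto simp: mark_of_def)
  also have "\<dots> = mset_set (Elt ` {1..m})"
    by (rule image_mset_mset_set) (auto simp: inj_on_def)
  finally have 1: "image_mset (mark_of m) (mset_set {1..m}) = mset_set (Elt ` {1..m})" .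
  have "image_mset (mark_of m) (mset_set (A - {1..m})) = image_mset (\<lambda>x. Star) (mset_set (A - {1..m}))"
    using assms by (intro image_mset_cong) (auto simp: mark_of_def)
  then have 2: "image_mset (mark_of m) (mset_set (A - {1..m})) = replicate_mset (card A - m) Star"
    using assms by (simp add: image_mset_const_eq card_Diff_subset)
  have "mset_set A = mset_set {1..m} + mset_set (A - {1..m})"
    using assms by (subst mset_set_Union[symmetric]) (auto simp: Un_absorb1)
  then show ?thesis by (simp only: 1 2 image_mset_union)
qed

lemma
  assumes "permutation \<sigma>" "\<sigma> ` A \<subseteq> A" "finite A" "{1..m} \<subseteq> A"
  shows marked_cycle_shape_shape_of: "marked_cycle_shape m (shape_of m \<sigma> A)"
    and shape_size_shape_of: "shape_size m (shape_of m \<sigma> A) = card A"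
proof -
  have "m \<le> card A" using card_mono[OF assms(3,4)] by simp
  then show "shape_size m (shape_of m \<sigma> A) = card A"
    by (auto simp: shape_size_def shape_letters_shape_of[OF assms(1-3)] image_mark_of[OF assms(3,4)]
        count_mset_set')
  show "marked_cycle_shape m (shape_of m \<sigma> A)"
    by (auto simp: marked_cycle_shape_def shape_letters_shape_of[OF assms(1-3)]
        image_mark_of[OF assms(3,4)] count_mset_set' in_replicate_mset)
qed

lemma permutes_permutation: "\<sigma> permutes A \<Longrightarrow> finite A \<Longrightarrow> permutation \<sigma>"
  by (auto simp: permutation_permutes)

lemma core_subset:
  assumes "\<sigma> permutes {1..n}" "m \<le> n" shows "core m \<sigma> \<subseteq> {1..n}"
  using assms by (auto simp: core_def permutes_def)

text \<open>A point of \<open>{1..n}\<close> outside the core is fixed and lies outside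
  \<open>{1..m}\<close>, so it contributes one \<open>star_cycle\<close>.\<close>

lemma marked_cycle_type_core:
  assumes "\<sigma> permutes {1..n}" "m \<le> n"
  shows "marked_cycle_type m n \<sigma> =
    shape_of m \<sigma> (core m \<sigma>) + replicate_mset (n - card (core m \<sigma>)) star_cycle"
proof -
  have p: "permutation \<sigma>" using assms(1) by (rule permutes_permutation) simp
  note sub = core_subset[OF assms]
  have "shape_of m \<sigma> (core m \<sigma> \<union> ({1..n} - core m \<sigma>)) =
      shape_of m \<sigma> (core m \<sigma>) + shape_of m \<sigma> ({1..n} - core m \<sigma>)"
    using core_invariant[OF permutes_inj[OF assms(1)]] finite_core[OF p]
    by (intro shape_of_Un[OF p]) auto
  moreover have "shape_of m \<sigma> ({1..n} - core m \<sigma>) =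
      replicate_mset (n - card (core m \<sigma>)) star_cycle"
    using shape_of_fixed[of "{1..n} - core m \<sigma>" \<sigma> m] sub finite_core[OF p]
    by (force simp: core_def card_Diff_subset)
  moreover have "core m \<sigma> \<union> ({1..n} - core m \<sigma>) = {1..n}" using sub by auto
  ultimately show ?thesis by (simp add: marked_cycle_type_eq)
qed

lemma marked_cycle_type_in_marked_shapes:
  assumes "\<sigma> permutes {1..n}" "m \<le> n"
  shows "marked_cycle_type m n \<sigma> \<in> marked_shapes m n"
  using marked_cycle_shape_shape_of[of \<sigma> "{1..n}" m] shape_size_shape_of[of \<sigma> "{1..n}" m]
    permutes_permutation[OF assms(1)] permutes_image[OF assms(1)] assms(2)
  by (simp add: marked_shapes_def marked_cycle_type_eq)

lemma shape_size_core:
  assumes "permutation \<sigma>"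
  shows "shape_size m (shape_of m \<sigma> (core m \<sigma>)) = card (core m \<sigma>)"
  using shape_size_shape_of[OF assms core_invariant finite_core[OF assms], of m m]
    assms by (auto simp: core_def permutation bij_is_inj)

text \<open>Both types are a part free of \<open>star_cycle\<close> plus copies of
  \<open>star_cycle\<close>: on the left by \<open>star_notin_core\<close>, on the right by
  properness. Filtering recovers the free parts; conversely their size determines the number of
  copies. This removes \<open>n\<close> from the condition on the factors.\<close>

lemma marked_cycle_type_eq_pad_iff:
  assumes "\<sigma> permutes {1..n}" "m \<le> n" "proper_shape lam" "shape_size m lam \<le> n"
  shows "marked_cycle_type m n \<sigma> = pad_shape m n lam \<longleftrightarrow> shape_of m \<sigma> (core m \<sigma>) = lam"
proof
  have p: "permutation \<sigma>" using assms(1) by (rule permutes_permutation) simp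
  {
    assume "shape_of m \<sigma> (core m \<sigma>) = lam"
    then show "marked_cycle_type m n \<sigma> = pad_shape m n lam"
      using shape_size_core[OF p, of m] marked_cycle_type_core[OF assms(1,2)]
      by (simp add: pad_shape_def)
  next
    let ?f = "filter_mset (\<lambda>c. c \<noteq> star_cycle)"
    assume "marked_cycle_type m n \<sigma> = pad_shape m n lam"
    then have "?f (shape_of m \<sigma> (core m \<sigma>) + replicate_mset (n - card (core m \<sigma>)) star_cycle) =
        ?f (lam + replicate_mset (n - shape_size m lam) star_cycle)"
      using marked_cycle_type_core[OF assms(1,2)] by (simp add: pad_shape_def)
    moreover have "?f (replicate_mset k star_cycle) = {#}" for k
      by (auto simp: filter_mset_eq_conv)
    moreover have "?f (shape_of m \<sigma> (core m \<sigma>)) = shape_of m \<sigma> (core m \<sigma>)"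
      using star_notin_core[OF p, of m] by (auto simp: filter_mset_eq_conv)
    moreover have "?f lam = lam"
      using assms(3) by (auto simp: filter_mset_eq_conv proper_shape_def m1_def count_eq_zero_iff)
    ultimately show "shape_of m \<sigma> (core m \<sigma>) = lam" by simp
  }
qed

section \<open>Conjugacy and realisation\<close>

text \<open>Used to pair the cycles of two permutations that have the same marked word. The
  induction matches \<open>a\<close> with some \<open>b\<close> of equal value and removes
  both.\<close>

lemma image_mset_eq_imp_bij_betw:
  assumes "finite A" "finite B" "image_mset f (mset_set A) = image_mset g (mset_set B)"
  shows "\<exists>h. bij_betw h A B \<and> (\<forall>a\<in>A. f a = g (h a))"
  using assms
proof (induction A arbitrary: B rule: finite_induct)
  case empty
  then have "B = {}" by (simp add: mset_set_empty_iff)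
  then show ?case by (auto simp: bij_betw_def)
next
  case (insert a A)
  have "f a \<in># image_mset g (mset_set B)"
    using insert.prems(2)[symmetric] insert.hyps by simp
  then obtain b where b: "b \<in> B" "f a = g b" using insert.prems(1) by auto
  have "mset_set B = add_mset b (mset_set (B - {b}))"
    using b insert.prems(1) by (metis mset_set.remove)
  then have "image_mset f (mset_set A) = image_mset g (mset_set (B - {b}))"
    using insert.prems(2) insert.hyps b by simp
  from insert.IH[OF _ this] insert.prems(1) obtain h where
    h: "bij_betw h A (B - {b})" "\<forall>a\<in>A. f a = g (h a)" by auto
  let ?h = "h(a := b)"
  have "bij_betw ?h A (B - {b})"
    using h(1) insert.hyps(2) by (subst bij_betw_cong[of A ?h h]) auto
  then have "bij_betw ?h (insert a A) (insert b (B - {b}))"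
    using insert.hyps(2) notIn_Un_bij_betw3[of a A ?h "B - {b}"] by auto
  then have "bij_betw ?h (insert a A) B" using b(1) by (simp add: insert_absorb)
  moreover have "\<forall>c\<in>insert a A. f c = g (?h c)" using h(2) b(2) insert.hyps(2) by auto
  ultimately show ?case by blast
qed

text \<open>Equal cyclic words agree as lists only up to rotation; moving the starting point along
  the cycle of \<open>y\<close> absorbs that rotation.\<close>

lemma matching_representatives:
  assumes "permutation \<sigma>" "permutation \<tau>" "\<tau> ` A \<subseteq> A" "x \<in> A" "y \<in> A"
    and "map_cyclic_word f (cyc \<sigma> x) = map_cyclic_word f (cyc \<tau> y)"
  shows "\<exists>y'\<in>A. cyc \<tau> y' = cyc \<tau> y \<and> map f (support \<sigma> x) = map f (support \<tau> y')"
proof -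
  note ne = support_nonempty[OF assms(1)] support_nonempty[OF assms(2)]
  have "abs_cyclic_word (map f (support \<tau> y)) = abs_cyclic_word (map f (support \<sigma> x))"
    using assms(6) unfolding map_cyclic_word_abs[OF ne(1)] map_cyclic_word_abs[OF ne(2)] by simp
  then obtain k where "map f (support \<sigma> x) = rotate k (map f (support \<tau> y))"
    using ne by (metis abs_cyclic_word_eq_iff map_is_Nil_conv)
  then have "map f (support \<sigma> x) = map f (support \<tau> ((\<tau> ^^ k) y))"
    by (simp only: support_funpow[OF assms(2)] rotate_map)
  moreover have "cyc \<tau> ((\<tau> ^^ k) y) = cyc \<tau> y"
    using cyc_eq_iff[OF assms(2)] by metis
  moreover have "(\<tau> ^^ k) y \<in> A" using funpow_in_invariant[OF assms(2,3,5)] .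
  ultimately show ?thesis by blast
qed

text \<open>Pair the cycles with equal marked words, choose base points \<open>X c\<close> and
  \<open>Y c\<close> at which the marked words agree as lists, and send
  \<open>(\<sigma> ^^ i) (X c)\<close> to \<open>(\<tau> ^^ i) (Y c)\<close>.\<close>

lemma conjugate_if_same_shape:
  assumes "\<sigma> permutes A" "\<tau> permutes A" "finite A" "shape_of m \<sigma> A = shape_of m \<tau> A"
  obtains \<theta> where "\<theta> permutes A" "\<And>a. a \<in> {1..m} \<Longrightarrow> \<theta> a = a" "\<tau> \<circ> \<theta> = \<theta> \<circ> \<sigma>"
proof -
  have p: "permutation \<sigma>" "permutation \<tau>"
    using assms(1-3) by (auto intro: permutes_permutation)
  have inv: "\<sigma> ` A \<subseteq> A" "\<tau> ` A \<subseteq> A"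
    using assms(1,2) by (simp_all add: permutes_image)
  let ?f = "map_cyclic_word (mark_of m)"
  obtain h where h: "bij_betw h (cyc \<sigma> ` A) (cyc \<tau> ` A)" "\<forall>c\<in>cyc \<sigma> ` A. ?f c = ?f (h c)"
    using image_mset_eq_imp_bij_betw[of "cyc \<sigma> ` A" "cyc \<tau> ` A" ?f ?f] assms(3,4)
    by (auto simp: shape_of_def)
  define Q where "Q c x y \<longleftrightarrow> x \<in> A \<and> y \<in> A \<and> cyc \<sigma> x = c \<and> cyc \<tau> y = h c \<and>
      map (mark_of m) (support \<sigma> x) = map (mark_of m) (support \<tau> y)" for c x y
  have "\<exists>x y. Q c x y" if "c \<in> cyc \<sigma> ` A" for c
  proof -
    obtain x where x: "x \<in> A" "c = cyc \<sigma> x" using \<open>c \<in> cyc \<sigma> ` A\<close> by blast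
    have "h c \<in> cyc \<tau> ` A" using h(1) that by (rule bij_betw_apply)
    then obtain y where y: "y \<in> A" "h c = cyc \<tau> y" by blast
    have "?f c = ?f (h c)" using h(2) that by blast
    then have "?f (cyc \<sigma> x) = ?f (cyc \<tau> y)" unfolding y(2) unfolding x(2) .
    from matching_representatives[OF p inv(2) x(1) y(1) this]
    obtain y' where y': "y' \<in> A" "cyc \<tau> y' = cyc \<tau> y"
      "map (mark_of m) (support \<sigma> x) = map (mark_of m) (support \<tau> y')"
      by (elim bexE conjE)
    have "Q c x y'" unfolding Q_def
      by (intro conjI x(1) x(2)[symmetric] y'(1) trans[OF y'(2) y(2)[symmetric]] y'(3))
    then show ?thesis by blast
  qed
  then obtain X Y where "\<And>c. c \<in> cyc \<sigma> ` A \<Longrightarrow> Q c (X c) (Y c)"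
    by metis
  note XY = this[unfolded Q_def]
  have len: "least_power \<sigma> (X c) = least_power \<tau> (Y c)" if "c \<in> cyc \<sigma> ` A" for c
    using XY[OF that] by (metis length_map length_upt minus_nat.diff_0)
  have rep: "\<exists>i. z = (\<sigma> ^^ i) (X (cyc \<sigma> z))" if "z \<in> A" for z
    using XY[of "cyc \<sigma> z"] cyc_eq_iff[OF p(1)] that by blast
  \<comment> \<open>The exponent is an arbitrary choice; the next fact shows that every exponent
    gives the same value, because paired cycles have equal length.\<close>
  define \<theta> where "\<theta> z = (if z \<in> A
      then (\<tau> ^^ (SOME i. z = (\<sigma> ^^ i) (X (cyc \<sigma> z)))) (Y (cyc \<sigma> z)) else z)" for z
  have \<theta>: "\<theta> ((\<sigma> ^^ i) (X c)) = (\<tau> ^^ i) (Y c)" if c: "c \<in> cyc \<sigma> ` A" for i c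
  proof -
    let ?z = "(\<sigma> ^^ i) (X c)"
    have "?z \<in> A" using XY[OF c] funpow_in_invariant[OF p(1) inv(1)] by blast
    moreover have cz: "cyc \<sigma> ?z = c" using XY[OF c] cyc_eq_iff[OF p(1)] by metis
    moreover define k where "k = (SOME k. ?z = (\<sigma> ^^ k) (X (cyc \<sigma> ?z)))"
    ultimately have zk: "\<theta> ?z = (\<tau> ^^ k) (Y c)" "?z = (\<sigma> ^^ k) (X c)"
      using someI_ex[OF rep[of ?z]] by (simp_all add: \<theta>_def)
    have "(\<tau> ^^ i) (Y c) = (\<tau> ^^ k) (Y c)"
      using zk(2) unfolding funpow_eq_iff_cong[OF p(1)] funpow_eq_iff_cong[OF p(2)] len[OF c] .
    with zk(1) show ?thesis by (rule trans[OF _ sym])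
  qed
  have rep': "\<exists>c i. c \<in> cyc \<sigma> ` A \<and> z = (\<sigma> ^^ i) (X c)" if "z \<in> A" for z
    using rep[OF that] that by blast
  have mark: "mark_of m (\<theta> z) = mark_of m z" if zA: "z \<in> A" for z
  proof -
    obtain c i where c: "c \<in> cyc \<sigma> ` A" and i: "z = (\<sigma> ^^ i) (X c)" using rep'[OF zA] by blast
    \<comment> \<open>Below the common cycle length the exponent is a position in both words, and
      the marks agree there.\<close>
    define j where "j = i mod least_power \<sigma> (X c)"
    have j: "j < least_power \<sigma> (X c)" "j < least_power \<tau> (Y c)"
      using least_power_of_permutation(2)[OF p(2), of "Y c"] by (simp_all add: j_def len[OF c])
    have "z = (\<sigma> ^^ j) (X c)"
      unfolding i funpow_eq_iff_cong[OF p(1)] by (simp add: j_def)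
    moreover have "\<theta> z = (\<tau> ^^ j) (Y c)"
      unfolding i \<theta>[OF c] funpow_eq_iff_cong[OF p(2)] by (simp add: j_def len[OF c])
    moreover have "map (mark_of m) (support \<sigma> (X c)) ! j = map (mark_of m) (support \<tau> (Y c)) ! j"
      using XY[OF c] by simp
    ultimately show ?thesis using j by simp
  qed
  have into: "\<theta> z \<in> A" if "z \<in> A" for z
    using XY[of "cyc \<sigma> z"] funpow_in_invariant[OF p(2) inv(2)] that by (auto simp: \<theta>_def)
  have "inj_on \<theta> A"
  proof (rule inj_onI)
    fix z w assume zw: "z \<in> A" "w \<in> A" "\<theta> z = \<theta> w"
    obtain c i where c: "c \<in> cyc \<sigma> ` A" and i: "z = (\<sigma> ^^ i) (X c)" using rep'[OF zw(1)] by blast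
    obtain d j where d: "d \<in> cyc \<sigma> ` A" and j: "w = (\<sigma> ^^ j) (X d)" using rep'[OF zw(2)] by blast
    have eq: "(\<tau> ^^ i) (Y c) = (\<tau> ^^ j) (Y d)"
      using zw(3) unfolding i j \<theta>[OF c] \<theta>[OF d] .
    then have "cyc \<tau> (Y c) = cyc \<tau> (Y d)"
      using cyc_eq_iff[OF p(2)] by metis
    then have "h c = h d" using XY[OF c] XY[OF d] by simp
    then have cd: "c = d" using h(1) c d by (meson bij_betw_def inj_onD)
    have "(\<sigma> ^^ i) (X c) = (\<sigma> ^^ j) (X c)"
      using eq unfolding cd[symmetric] funpow_eq_iff_cong[OF p(1)] funpow_eq_iff_cong[OF p(2)] len[OF c] .
    then show "z = w" using i j cd by simp
  qed
  then have "bij_betw \<theta> A A"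
    using into assms(3) by (simp add: bij_betw_def endo_inj_surj image_subsetI)
  then have perm: "\<theta> permutes A"
    by (rule bij_imp_permutes) (simp add: \<theta>_def)
  \<comment> \<open>Marks are preserved, and \<open>a\<close> is the only point with mark
    \<open>Elt a\<close>.\<close>
  moreover have "\<theta> a = a" if "a \<in> {1..m}" for a
  proof (cases "a \<in> A")
    case True
    then show ?thesis using mark[of a] that by (simp add: mark_of_def split: if_splits)
  qed (simp add: \<theta>_def)
  moreover have "\<tau> \<circ> \<theta> = \<theta> \<circ> \<sigma>"
  proof
    fix z
    show "(\<tau> \<circ> \<theta>) z = (\<theta> \<circ> \<sigma>) z"
    proof (cases "z \<in> A")
      case True
      obtain c i where c: "c \<in> cyc \<sigma> ` A" and i: "z = (\<sigma> ^^ i) (X c)" using rep'[OF True] by blast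
      have "\<sigma> z = (\<sigma> ^^ Suc i) (X c)" using i by simp
      then show ?thesis
        using \<theta>[OF c, of "Suc i"] \<theta>[OF c, of i] i by simp
    next
      case False
      then show ?thesis using assms(1,2) perm by (simp add: permutes_not_in)
    qed
  qed
  ultimately show thesis using that by blast
qed

section \<open>Realising every shape by a permutation\<close>

lemma cyc_cycle_of_list:
  assumes "distinct w" "permutation \<sigma>" "\<And>z. z \<in> set w \<Longrightarrow> \<sigma> z = cycle_of_list w z" "x \<in> set w"
  shows "cyc \<sigma> x = abs_cyclic_word w"
proof -
  have ne: "w \<noteq> []" using assms(4) by auto
  have "\<sigma> ` set w \<subseteq> set w"
    using assms(3) cycle_is_surj[OF assms(1)] by auto
  then have "(\<sigma> ^^ k) z \<in> set w" if "z \<in> set w" for k z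
    using funpow_in_invariant[OF assms(2)] that by blast
  then have "(\<sigma> ^^ k) z = (cycle_of_list w ^^ k) z" if "z \<in> set w" for k z
    using assms(3) that by (induction k) (simp, metis comp_apply funpow.simps(2))
  \<comment> \<open>Applying the cycle \<open>k\<close> times rotates the word by \<open>k\<close>
    places, which makes the orbit of \<open>w ! 0\<close> explicit.\<close>
  then have "map (\<sigma> ^^ k) w = map (cycle_of_list w ^^ k) w" for k by simp
  then have rot: "map (\<sigma> ^^ k) w = rotate k w" for k by (simp add: cyclic_rotation[OF assms(1)])
  have pow: "(\<sigma> ^^ k) (w ! 0) = w ! (k mod length w)" for k
    using arg_cong[OF rot[of k], of "\<lambda>u. u ! 0"] ne by (simp add: nth_rotate)
  have "(\<sigma> ^^ k) (w ! 0) = w ! 0 \<longleftrightarrow> length w dvd k" for k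
    using ne assms(1) by (auto simp: pow nth_eq_iff_index_eq mod_eq_0_iff_dvd)
  then have dvd: "least_power \<sigma> (w ! 0) dvd k \<longleftrightarrow> length w dvd k" for k
    by (simp add: least_power_dvd[OF assms(2)])
  \<comment> \<open>The two numbers have the same multiples, so they divide each other.\<close>
  have len: "least_power \<sigma> (w ! 0) = length w"
    using dvd[of "length w"] dvd[of "least_power \<sigma> (w ! 0)"] by (auto intro: dvd_antisym)
  have "support \<sigma> (w ! 0) = w"
    by (rule nth_equalityI) (simp_all add: len pow)
  then have "cyc \<sigma> (w ! 0) = abs_cyclic_word w" by simp
  moreover have "cyc \<sigma> (w ! 0) = cyc \<sigma> x"
    using assms(4) pow cyc_eq_iff[OF assms(2)] by (metis in_set_conv_nth mod_less)
  ultimately show ?thesis by simp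
qed

text \<open>The witness is a product of disjoint cycles: a new cycle acts trivially on the letters
  of the earlier words, whose orbits therefore do not change.\<close>

lemma exists_permutation_with_cycles:
  assumes "distinct (concat ws)"
  shows "\<exists>\<sigma>. \<sigma> permutes set (concat ws) \<and>
    (\<forall>w\<in>set ws. \<forall>x\<in>set w. cyc \<sigma> x = abs_cyclic_word w)"
  using assms
proof (induction ws)
  case Nil
  then show ?case using permutes_id by auto
next
  case (Cons w ws)
  then obtain \<tau> where \<tau>: "\<tau> permutes set (concat ws)"
    "\<And>v x. v \<in> set ws \<Longrightarrow> x \<in> set v \<Longrightarrow> cyc \<tau> x = abs_cyclic_word v" by auto
  have dw: "distinct w" and disj: "set w \<inter> set (concat ws) = {}" using Cons.prems by auto
  define \<sigma> where "\<sigma> = cycle_of_list w \<circ> \<tau>"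
  have perm: "\<sigma> permutes set (concat (w # ws))"
    unfolding \<sigma>_def using \<tau>(1) cycle_permutes[of w]
    by (intro permutes_compose) (auto elim: permutes_subset)
  then have p: "permutation \<sigma>" by (rule permutes_permutation) simp
  have pt: "permutation \<tau>" using \<tau>(1) by (rule permutes_permutation) simp
  have on_w: "\<sigma> z = cycle_of_list w z" if "z \<in> set w" for z
    using that disj \<tau>(1) by (simp add: \<sigma>_def permutes_not_in disjoint_iff)
  have off_w: "\<sigma> z = \<tau> z" if "z \<in> set (concat ws)" for z
  proof -
    have "\<tau> z \<in> set (concat ws)" using that \<tau>(1) permutes_in_image by metis
    then have "\<tau> z \<notin> set w" using disj by blast
    then show ?thesis by (simp add: \<sigma>_def id_outside_supp)
  qed
  have "cyc \<sigma> x = cyc \<tau> x" if x: "x \<in> set (concat ws)" for x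
  proof -
    have "(\<tau> ^^ k) x \<in> set (concat ws)" for k
      using funpow_in_invariant[OF pt _ x] permutes_image[OF \<tau>(1)] by simp
    then have *: "(\<sigma> ^^ k) x = (\<tau> ^^ k) x" for k
      by (induction k) (simp_all add: off_w del: set_concat)
    then have "least_power \<sigma> x = least_power \<tau> x" by (simp add: least_power_def)
    then show ?thesis by (simp add: *)
  qed
  then have "cyc \<sigma> x = abs_cyclic_word v" if "v \<in> set ws" "x \<in> set v" for v x
    using \<tau>(2)[OF that] that by (metis UN_I set_concat)
  moreover have "cyc \<sigma> x = abs_cyclic_word w" if "x \<in> set w" for x
    using cyc_cycle_of_list[OF dw p on_w that] .
  ultimately show ?case using perm by (intro exI[of _ \<sigma>]) auto
qed

text \<open>Nonempty words with disjoint letters represent distinct cyclic words, so the set of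
  cycles and the list of words count the same.\<close>

lemma mset_cycles_of_words:
  assumes "distinct (concat ws)" "[] \<notin> set ws"
    "\<And>w x. w \<in> set ws \<Longrightarrow> x \<in> set w \<Longrightarrow> cyc \<sigma> x = abs_cyclic_word w"
  shows "mset_set (cyc \<sigma> ` set (concat ws)) = mset (map abs_cyclic_word ws)"
proof -
  have "cyc \<sigma> ` set (concat ws) = abs_cyclic_word ` set ws"
  proof (intro Set.equalityI subsetI)
    fix c assume "c \<in> abs_cyclic_word ` set ws"
    then obtain w where w: "w \<in> set ws" "c = abs_cyclic_word w" by blast
    then have "w \<noteq> []" using assms(2) by auto
    then have "hd w \<in> set w" by simp
    with w assms(3)[of w "hd w"] show "c \<in> cyc \<sigma> ` set (concat ws)" by force
  qed (use assms(3) in auto)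
  moreover have "distinct (map abs_cyclic_word ws)"
  proof -
    have "inj_on abs_cyclic_word (set ws)"
    proof (rule inj_onI)
      fix v w assume vw: "v \<in> set ws" "w \<in> set ws" "abs_cyclic_word v = abs_cyclic_word w"
      then have ne: "v \<noteq> []" "w \<noteq> []" using assms(2) by auto
      then have "mset v = mset w" using vw(3) letters_abs by metis
      then have "set v = set w" by (rule mset_eq_setD)
      then show "v = w"
        using assms(1) vw(1,2) ne unfolding distinct_concat_iff by (metis inf.idem set_empty)
    qed
    moreover have "distinct ws"
      using assms(1,2) by (simp add: distinct_concat_iff removeAll_id)
    ultimately show ?thesis by (simp add: distinct_map)
  qed
  ultimately show ?thesis by (metis mset_set_set set_map)
qed

lemma image_mset_eq_mset_imp_map:
  assumes "image_mset f M = mset xs"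
  shows "\<exists>ys. mset ys = M \<and> map f ys = xs"
proof -
  obtain zs where zs: "mset zs = M" using ex_mset by blast
  with assms have "mset xs = mset (map f zs)" by simp
  then obtain p where p: "p permutes {..<length (map f zs)}" "permute_list p (map f zs) = xs"
    by (rule mset_eq_permutation)
  then show ?thesis
    using zs by (intro exI[of _ "permute_list p zs"]) (simp add: permute_list_map)
qed

lemma map_eq_concat_imp:
  "map f xs = concat vs \<Longrightarrow> \<exists>ws. concat ws = xs \<and> map (map f) ws = vs"
proof (induction vs arbitrary: xs)
  case (Cons v vs)
  then obtain w ys where *: "xs = w @ ys" "map f w = v" "map f ys = concat vs"
    by (auto simp: map_eq_append_conv)
  with Cons.IH obtain ws where "concat ws = ys" "map (map f) ws = vs" by blast
  with * show ?case by (intro exI[of _ "w # ws"]) simp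
qed simp

lemma ex_words_of_shape:
  "\<exists>vs. [] \<notin> set vs \<and> mset (map abs_cyclic_word vs) = \<rho>"
proof (induction \<rho>)
  case (add c \<rho>)
  then obtain vs where "[] \<notin> set vs" "mset (map abs_cyclic_word vs) = \<rho>" by blast
  moreover obtain v where "v \<noteq> []" "c = abs_cyclic_word v" by (rule cyclic_word_exhaust)
  ultimately show ?case by (intro exI[of _ "v # vs"]) auto
qed simp

lemma shape_letters_words:
  "[] \<notin> set vs \<Longrightarrow> shape_letters (mset (map abs_cyclic_word vs)) = mset (concat vs)"
  by (induction vs) (auto simp: shape_letters_def letters_abs)

text \<open>The shape condition fixes the multiplicity of every \<open>Elt\<close> and the size
  fixes that of \<open>Star\<close>.\<close>

lemma shape_letters_eq:
  assumes "\<rho> \<in> marked_shapes m n"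
  shows "shape_letters \<rho> = image_mset (mark_of m) (mset_set {1..n})"
proof -
  have "m \<le> n" "count (shape_letters \<rho>) Star = n - m"
    using assms by (auto simp: marked_shapes_def shape_size_def)
  moreover have "set_mset (shape_letters \<rho>) \<subseteq> insert Star (Elt ` {1..m})"
    "\<forall>a\<in>{1..m}. count (shape_letters \<rho>) (Elt a) = 1"
    using assms by (auto simp: marked_shapes_def marked_cycle_shape_def)
  moreover from this(1) have "count (shape_letters \<rho>) (Elt a) = 0" if "a \<notin> {1..m}" for a
    using that by (intro iffD2[OF count_eq_zero_iff]) blast
  ultimately have "count (shape_letters \<rho>) x =
      count (mset_set (Elt ` {1..m}) + replicate_mset (n - m) Star) x" for x
    by (cases x) (force simp: count_mset_set')+
  then show ?thesis
    using image_mark_of[of "{1..n}" m] \<open>m \<le> n\<close> by (simp add: multiset_eq_iff)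
qed

text \<open>Write the shape as words in marks, replace their letters by distinct points of
  \<open>{1..n}\<close> with those marks, and take a permutation whose cycles are the resulting
  words.\<close>

lemma marked_shape_realised:
  assumes "\<rho> \<in> marked_shapes m n"
  obtains \<sigma> where "\<sigma> permutes {1..n}" "marked_cycle_type m n \<sigma> = \<rho>"
proof -
  obtain vs where vs: "[] \<notin> set vs" "mset (map abs_cyclic_word vs) = \<rho>"
    using ex_words_of_shape by blast
  then have "image_mset (mark_of m) (mset_set {1..n}) = mset (concat vs)"
    using shape_letters_words[OF vs(1)] shape_letters_eq[OF assms] by simp
  then obtain xs where xs: "mset xs = mset_set {1..n}" "map (mark_of m) xs = concat vs"
    using image_mset_eq_mset_imp_map by blast
  then obtain ws where ws: "concat ws = xs" "map (map (mark_of m)) ws = vs"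
    using map_eq_concat_imp by blast
  have "distinct xs" "set xs = {1..n}"
    using xs(1) mset_eq_setD[of xs "[1..<Suc n]"] mset_eq_imp_distinct_iff[of xs "[1..<Suc n]"]
      mset_set_set[of "[1..<Suc n]"]
    by (simp_all add: atLeastLessThanSuc_atLeastAtMost del: upt_Suc)
  then have d: "distinct (concat ws)" "set (concat ws) = {1..n}" using ws(1) by simp_all
  have ne: "[] \<notin> set ws" using vs(1) ws(2) by auto
  obtain \<sigma> where \<sigma>: "\<sigma> permutes {1..n}"
    "\<And>w x. w \<in> set ws \<Longrightarrow> x \<in> set w \<Longrightarrow> cyc \<sigma> x = abs_cyclic_word w"
    using exists_permutation_with_cycles[OF d(1)] d(2) by auto
  have "marked_cycle_type m n \<sigma> = image_mset (map_cyclic_word (mark_of m)) (mset (map abs_cyclic_word ws))"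
    using mset_cycles_of_words[OF d(1) ne \<sigma>(2)] d(2)
    by (simp add: marked_cycle_type_eq shape_of_def)
  also have "\<dots> = mset (map (map_cyclic_word (mark_of m) \<circ> abs_cyclic_word) ws)"
    by (simp add: multiset.map_comp)
  also have "map (map_cyclic_word (mark_of m) \<circ> abs_cyclic_word) ws = map abs_cyclic_word vs"
    unfolding ws(2)[symmetric] map_map
    using ne by (intro map_cong refl) (metis comp_apply map_cyclic_word_abs)
  finally show thesis using that[OF \<sigma>(1)] vs(2) by simp
qed

section \<open>Structure coefficients as numbers of factorisations\<close>

definition conj_by :: "(nat \<Rightarrow> nat) \<Rightarrow> (nat \<Rightarrow> nat) \<Rightarrow> nat \<Rightarrow> nat" where
  "conj_by \<theta> \<sigma> = \<theta> \<circ> \<sigma> \<circ> inv' \<theta>"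

lemma conj_by_comp: "bij \<theta> \<Longrightarrow> conj_by \<theta> \<sigma> \<circ> \<theta> = \<theta> \<circ> \<sigma>"
  by (simp add: conj_by_def fun_eq_iff bij_is_inj)

lemma conj_by_apply: "bij \<theta> \<Longrightarrow> conj_by \<theta> \<sigma> (\<theta> x) = \<theta> (\<sigma> x)"
  by (simp add: conj_by_def bij_is_inj)

lemma conj_by_eqI:
  assumes "bij \<theta>" "\<tau> \<circ> \<theta> = \<theta> \<circ> \<sigma>" shows "conj_by \<theta> \<sigma> = \<tau>"
proof -
  have "\<theta> \<circ> inv' \<theta> = id" using assms(1) bij_is_surj surj_iff by blast
  then show ?thesis unfolding conj_by_def assms(2)[symmetric] by (simp add: comp_assoc)
qed

lemma conj_by_mult:
  "bij \<theta> \<Longrightarrow> conj_by \<theta> \<sigma> \<circ> conj_by \<theta> \<tau> = conj_by \<theta> (\<sigma> \<circ> \<tau>)"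
  by (simp add: conj_by_def fun_eq_iff bij_is_inj)

lemma conj_by_inject:
  assumes "bij \<theta>" shows "conj_by \<theta> \<sigma> = conj_by \<theta> \<tau> \<longleftrightarrow> \<sigma> = \<tau>"
proof
  assume *: "conj_by \<theta> \<sigma> = conj_by \<theta> \<tau>"
  show "\<sigma> = \<tau>"
  proof
    fix x
    have "\<theta> (\<sigma> x) = \<theta> (\<tau> x)" using * assms by (metis conj_by_apply)
    then show "\<sigma> x = \<tau> x" using assms by (simp add: bij_is_inj inj_eq)
  qed
qed simp

lemma conj_by_permutes:
  assumes "bij \<theta>" "\<sigma> permutes A" shows "conj_by \<theta> \<sigma> permutes \<theta> ` A"
proof -
  have "bij (conj_by \<theta> \<sigma>)"
    unfolding conj_by_def by (intro bij_comp bij_imp_bij_inv assms(1) permutes_bij[OF assms(2)])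
  moreover have "conj_by \<theta> \<sigma> y = y" if "y \<notin> \<theta> ` A" for y
  proof -
    obtain x where x: "y = \<theta> x" using assms(1) by (metis bij_pointE)
    then have "x \<notin> A" using that by blast
    then show ?thesis using x assms by (simp add: conj_by_apply permutes_not_in)
  qed
  ultimately show ?thesis
    unfolding permutes_def by (metis bij_iff)
qed

definition factorisations ::
    "nat \<Rightarrow> nat \<Rightarrow> shape \<Rightarrow> shape \<Rightarrow> (nat \<Rightarrow> nat) \<Rightarrow> ((nat \<Rightarrow> nat) \<times> (nat \<Rightarrow> nat)) set" where
  "factorisations m n lam \<delta> \<pi> = {(\<sigma>, \<tau>). \<sigma> permutes {1..n} \<and> \<tau> permutes {1..n} \<and> \<sigma> \<circ> \<tau> = \<pi> \<and>
     marked_cycle_type m n \<sigma> = lam \<and> marked_cycle_type m n \<tau> = \<delta>}"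

lemma finite_factorisations: "finite (factorisations m n lam \<delta> \<pi>)"
  by (rule finite_subset[of _ "{\<sigma>. \<sigma> permutes {1..n}} \<times> {\<sigma>. \<sigma> permutes {1..n}}"])
    (auto simp: factorisations_def intro!: finite_permutations)

lemma marked_cycle_type_conj_by:
  assumes "\<theta> permutes {1..n}" "\<And>a. a \<in> {1..m} \<Longrightarrow> \<theta> a = a" "\<sigma> permutes {1..n}"
  shows "marked_cycle_type m n (conj_by \<theta> \<sigma>) = marked_cycle_type m n \<sigma>"
  using shape_of_conj[where A = "{1..n}", OF permutes_permutation[OF assms(3) finite_atLeastAtMost]
      permutes_bij[OF assms(1)] assms(2) conj_by_comp[OF permutes_bij[OF assms(1)]]]
  unfolding marked_cycle_type_eq permutes_image[OF assms(1)] by simp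

text \<open>A permutation \<open>\<theta>\<close> that conjugates \<open>\<pi>\<close> to
  \<open>\<pi>'\<close> and fixes \<open>{1..m}\<close> pointwise carries factorisations to
  factorisations, injectively and with the same types.\<close>

lemma card_factorisations_le:
  assumes "\<pi> permutes {1..n}" "\<pi>' permutes {1..n}"
    "marked_cycle_type m n \<pi> = marked_cycle_type m n \<pi>'"
  shows "card (factorisations m n lam \<delta> \<pi>) \<le> card (factorisations m n lam \<delta> \<pi>')"
proof -
  obtain \<theta> where \<theta>: "\<theta> permutes {1..n}" "\<And>a. a \<in> {1..m} \<Longrightarrow> \<theta> a = a" "\<pi>' \<circ> \<theta> = \<theta> \<circ> \<pi>"
    using conjugate_if_same_shape[OF assms(1,2)] assms(3) by (auto simp: marked_cycle_type_eq)
  note b = permutes_bij[OF \<theta>(1)]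
  note p = conj_by_permutes[OF b, of _ "{1..n}", unfolded permutes_image[OF \<theta>(1)]]
  show ?thesis
  proof (rule card_inj_on_le[OF _ _ finite_factorisations])
    let ?g = "map_prod (conj_by \<theta>) (conj_by \<theta>)"
    show "inj_on ?g (factorisations m n lam \<delta> \<pi>)"
      by (auto simp: inj_on_def conj_by_inject[OF b])
    show "?g ` factorisations m n lam \<delta> \<pi> \<subseteq> factorisations m n lam \<delta> \<pi>'"
      using p marked_cycle_type_conj_by[OF \<theta>(1,2)] conj_by_eqI[OF b \<theta>(3)]
      by (auto simp: factorisations_def conj_by_mult[OF b])
  qed
qed

lemma card_factorisations_cong:
  assumes "\<pi> permutes {1..n}" "\<pi>' permutes {1..n}"
    "marked_cycle_type m n \<pi> = marked_cycle_type m n \<pi>'"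
  shows "card (factorisations m n lam \<delta> \<pi>) = card (factorisations m n lam \<delta> \<pi>')"
  using card_factorisations_le[OF assms] card_factorisations_le[OF assms(2,1) assms(3)[symmetric]]
  by (rule antisym)

section \<open>Coordinates with respect to the class sums\<close>

lemma class_sum_apply:
  "class_sum m n lam \<pi> = of_bool (\<pi> permutes {1..n} \<and> marked_cycle_type m n \<pi> = lam)"
proof -
  let ?A = "{\<sigma> \<in> carrier (sym_group n). marked_cycle_type m n \<sigma> = lam}"
  have "finite ?A"
    by (simp add: sym_group_carrier finite_permutations)
  then have "(\<Sum>\<sigma>\<in>?A. perm_elem \<sigma> \<pi>) = of_bool (\<pi> \<in> ?A)"
    by (simp add: perm_elem_def of_bool_def)
  then show ?thesis by (simp add: class_sum_def sym_group_carrier)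
qed

lemma class_sum_mult:
  "(class_sum m n lam \<otimes>\<^bsub>centraliser_algebra n m\<^esub> class_sum m n \<delta>) \<pi> =
    int (card (factorisations m n lam \<delta> \<pi>))"
proof -
  let ?P = "{(\<sigma>, \<tau>). \<sigma> permutes {1..n} \<and> \<tau> permutes {1..n} \<and> \<sigma> \<circ> \<tau> = \<pi>}"
  have fin: "finite ?P"
    by (rule finite_subset[of _ "{\<sigma>. \<sigma> permutes {1..n}} \<times> {\<sigma>. \<sigma> permutes {1..n}}"])
      (auto intro!: finite_permutations)
  have "(class_sum m n lam \<otimes>\<^bsub>centraliser_algebra n m\<^esub> class_sum m n \<delta>) \<pi> =
      (\<Sum>(\<sigma>, \<tau>)\<in>?P. class_sum m n lam \<sigma> * class_sum m n \<delta> \<tau>)"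
    by (simp add: centraliser_algebra_def sym_group_ring_def sym_group_carrier sym_group_mult)
  also have "\<dots> = (\<Sum>p\<in>?P. of_bool (p \<in> factorisations m n lam \<delta> \<pi>))"
    by (rule sum.cong) (auto simp: class_sum_apply factorisations_def)
  also have "\<dots> = int (card (?P \<inter> factorisations m n lam \<delta> \<pi>))"
    using fin by (simp add: of_bool_def sum.If_cases)
  also have "?P \<inter> factorisations m n lam \<delta> \<pi> = factorisations m n lam \<delta> \<pi>"
    by (auto simp: factorisations_def)
  finally show ?thesis .
qed

text \<open>By realisation, every shape is the type of one of finitely many permutations.\<close>

lemma finite_marked_shapes: "finite (marked_shapes m n)"
proof (rule finite_surj)
  show "marked_shapes m n \<subseteq> marked_cycle_type m n ` {\<sigma>. \<sigma> permutes {1..n}}"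
    using marked_shape_realised by (auto simp: image_iff) metis
qed (simp add: finite_permutations)

text \<open>Exactly one class contains \<pi>, so evaluation at \<pi> reads off a single coordinate;
  this gives the uniqueness of coordinates below.\<close>

lemma sum_class_sum:
  assumes "m \<le> n"
  shows "(\<Sum>\<rho>\<in>marked_shapes m n. c \<rho> * class_sum m n \<rho> \<pi>) =
    (if \<pi> permutes {1..n} then c (marked_cycle_type m n \<pi>) else 0)"
proof (cases "\<pi> permutes {1..n}")
  case True
  then have "(\<Sum>\<rho>\<in>marked_shapes m n. c \<rho> * class_sum m n \<rho> \<pi>) =
      (\<Sum>\<rho>\<in>marked_shapes m n. if marked_cycle_type m n \<pi> = \<rho> then c \<rho> else 0)"
    by (intro sum.cong) (simp_all add: class_sum_apply)
  also have "\<dots> = c (marked_cycle_type m n \<pi>)"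
    using marked_cycle_type_in_marked_shapes[OF True assms] finite_marked_shapes by simp
  finally show ?thesis using True by simp
qed (simp add: class_sum_apply)

text \<open>The definite description is justified first. Existence: the number of factorisations is
  constant on each class, so a representative \<open>R \<rho>\<close> gives the coordinate.
  Uniqueness: evaluate both expansions at \<open>R \<rho>\<close>.\<close>

lemma structure_coeff_eq_card:
  assumes "\<pi> permutes {1..n}" "m \<le> n"
  shows "structure_coeff m n lam \<delta> (marked_cycle_type m n \<pi>) =
    int (card (factorisations m n lam \<delta> \<pi>))"
proof -
  let ?ok = "\<lambda>c. (\<forall>\<rho>. \<rho> \<notin> marked_shapes m n \<longrightarrow> c \<rho> = 0) \<and>
     class_sum m n lam \<otimes>\<^bsub>centraliser_algebra n m\<^esub> class_sum m n \<delta> =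
       (\<lambda>\<pi>. \<Sum>\<rho>\<in>marked_shapes m n. c \<rho> * class_sum m n \<rho> \<pi>)"
  define R where "R \<rho> = (SOME \<pi>. \<pi> permutes {1..n} \<and> marked_cycle_type m n \<pi> = \<rho>)" for \<rho>
  have R: "R \<rho> permutes {1..n}" "marked_cycle_type m n (R \<rho>) = \<rho>" if "\<rho> \<in> marked_shapes m n" for \<rho>
    using someI_ex[of "\<lambda>\<pi>. \<pi> permutes {1..n} \<and> marked_cycle_type m n \<pi> = \<rho>"]
      marked_shape_realised[OF that] unfolding R_def by blast+
  define c where "c \<rho> = (if \<rho> \<in> marked_shapes m n
      then int (card (factorisations m n lam \<delta> (R \<rho>))) else 0)" for \<rho>
  have c: "c (marked_cycle_type m n \<pi>) = int (card (factorisations m n lam \<delta> \<pi>))"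
    if "\<pi> permutes {1..n}" for \<pi>
  proof -
    have *: "marked_cycle_type m n \<pi> \<in> marked_shapes m n"
      using marked_cycle_type_in_marked_shapes[OF that assms(2)] .
    show ?thesis
      using card_factorisations_cong[OF R(1)[OF *] that R(2)[OF *]] * by (simp add: c_def)
  qed
  have "?ok c"
  proof (intro conjI ext)
    fix \<pi>
    show "(class_sum m n lam \<otimes>\<^bsub>centraliser_algebra n m\<^esub> class_sum m n \<delta>) \<pi> =
        (\<Sum>\<rho>\<in>marked_shapes m n. c \<rho> * class_sum m n \<rho> \<pi>)"
    proof (cases "\<pi> permutes {1..n}")
      case False
      \<comment> \<open>Off the symmetric group both sides vanish, since a product of permutations
        of \<open>{1..n}\<close> is again one.\<close>
      then have "factorisations m n lam \<delta> \<pi> = {}"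
        by (auto simp: factorisations_def dest: permutes_compose)
      with False show ?thesis by (simp add: class_sum_mult sum_class_sum[OF assms(2)])
    qed (simp add: class_sum_mult sum_class_sum[OF assms(2)] c)
  qed (simp add: c_def)
  moreover have "d = c" if "?ok d" for d
  proof
    fix \<rho>
    show "d \<rho> = c \<rho>"
    proof (cases "\<rho> \<in> marked_shapes m n")
      case True
      have "(class_sum m n lam \<otimes>\<^bsub>centraliser_algebra n m\<^esub> class_sum m n \<delta>) (R \<rho>) =
          (\<Sum>\<rho>'\<in>marked_shapes m n. d \<rho>' * class_sum m n \<rho>' (R \<rho>))"
        using that by simp
      then have "d (marked_cycle_type m n (R \<rho>)) = c (marked_cycle_type m n (R \<rho>))"
        using R(1)[OF True] by (simp add: class_sum_mult sum_class_sum[OF assms(2)] c)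
      then show ?thesis using R(2)[OF True] by simp
    next
      case False
      then show ?thesis using that by (simp add: c_def)
    qed
  qed
  ultimately have "structure_coeff m n lam \<delta> = c"
    unfolding structure_coeff_def by (intro the_equality) blast+
  then show ?thesis using c[OF assms(1)] by simp
qed

section \<open>Polynomiality and degree\<close>

text \<open>Stripped of all cycles \<open>(\<star>)\<close>, the marked cycle types of the factors no longer mention \<open>n\<close>;
  \<open>B\<close> is the set of points outside \<open>{1..r}\<close> that the factors move.\<close>

definition local_factorisations ::
    "nat \<Rightarrow> nat \<Rightarrow> shape \<Rightarrow> shape \<Rightarrow> (nat \<Rightarrow> nat) \<Rightarrow> nat set \<Rightarrow> ((nat \<Rightarrow> nat) \<times> (nat \<Rightarrow> nat)) set" where
  "local_factorisations m r lam \<delta> \<pi> B = {(\<sigma>, \<tau>). \<sigma> permutes {1..r} \<union> B \<and> \<tau> permutes {1..r} \<union> B \<and>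
     \<sigma> \<circ> \<tau> = \<pi> \<and> shape_of m \<sigma> (core m \<sigma>) = lam \<and> shape_of m \<tau> (core m \<tau>) = \<delta> \<and> (\<forall>x\<in>B. \<sigma> x \<noteq> x)}"

lemma finite_local_factorisations:
  "finite B \<Longrightarrow> finite (local_factorisations m r lam \<delta> \<pi> B)"
  by (rule finite_subset[of _ "{\<sigma>. \<sigma> permutes {1..r} \<union> B} \<times> {\<sigma>. \<sigma> permutes {1..r} \<union> B}"])
    (auto simp: local_factorisations_def intro!: finite_permutations)

section \<open>Dependence on the outer set only through its cardinality\<close>

lemma ex_permutes_image_eq:
  assumes "finite S" "B \<subseteq> S" "B' \<subseteq> S" "card B = card B'"
  obtains \<theta> where "\<theta> permutes S" "\<theta> ` B = B'"
proof -
  have fin: "finite B" "finite B'" using assms finite_subset by auto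
  obtain f where f: "bij_betw f B B'"
    using finite_same_card_bij[OF fin assms(4)] by blast
  \<comment> \<open>The complements also have equal size, so two bijections glue to a permutation of
    \<open>S\<close>.\<close>
  have "card (S - B) = card (S - B')" using assms fin by (simp add: card_Diff_subset)
  then obtain g where g: "bij_betw g (S - B) (S - B')"
    using finite_same_card_bij[of "S - B" "S - B'"] assms(1) by blast
  define \<theta> where "\<theta> x = (if x \<in> B then f x else if x \<in> S then g x else x)" for x
  have 1: "bij_betw \<theta> B B'"
    using f by (subst bij_betw_cong[of B \<theta> f]) (simp_all add: \<theta>_def)
  have 2: "bij_betw \<theta> (S - B) (S - B')"
    using g by (subst bij_betw_cong[of "S - B" \<theta> g]) (simp_all add: \<theta>_def)
  have "bij_betw \<theta> (B \<union> (S - B)) (B' \<union> (S - B'))"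
    by (rule bij_betw_combine[OF 1 2]) blast
  then have "bij_betw \<theta> S S" using assms(2,3) by (simp add: Un_absorb1)
  then have "\<theta> permutes S"
    by (rule bij_imp_permutes) (use assms(2) in \<open>auto simp: \<theta>_def\<close>)
  moreover have "\<theta> ` B = B'" using 1 by (rule bij_betw_imp_surj_on)
  ultimately show thesis using that by blast
qed

text \<open>Conjugate by a permutation of \<open>B \<union> B'\<close> taking \<open>B\<close> to
  \<open>B'\<close>. It fixes \<open>{1..r}\<close> pointwise, hence commutes with \<pi> and, as
  \<open>m \<le> r\<close>, preserves shapes.\<close>

lemma card_local_factorisations_le:
  assumes "\<pi> permutes {1..r}" "m \<le> r" "finite B" "finite B'" "B \<inter> {1..r} = {}" "B' \<inter> {1..r} = {}"
    "card B = card B'"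
  shows "card (local_factorisations m r lam \<delta> \<pi> B) \<le> card (local_factorisations m r lam \<delta> \<pi> B')"
proof -
  obtain \<theta> where \<theta>: "\<theta> permutes B \<union> B'" "\<theta> ` B = B'"
    using ex_permutes_image_eq[of "B \<union> B'" B B'] assms by auto
  note b = permutes_bij[OF \<theta>(1)]
  have fix_r: "\<theta> a = a" if "a \<in> {1..r}" for a
    using \<theta>(1) that assms(5,6) by (intro permutes_not_in) auto
  have fix_m: "\<theta> a = a" if "a \<in> {1..m}" for a
    using fix_r[of a] that assms(2) by simp
  have "\<pi> \<circ> \<theta> = \<theta> \<circ> \<pi>"
  proof
    fix x
    show "(\<pi> \<circ> \<theta>) x = (\<theta> \<circ> \<pi>) x"
    proof (cases "x \<in> {1..r}")
      case True
      then have "\<pi> x \<in> {1..r}" using assms(1) permutes_in_image by metis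
      then show ?thesis using fix_r[OF True] fix_r[of "\<pi> x"] by simp
    next
      case False
      then have "\<theta> x \<notin> {1..r}" using fix_r permutes_inj[OF \<theta>(1)] by (metis injD)
      with False show ?thesis using assms(1) by (simp add: permutes_not_in)
    qed
  qed
  then have conj_\<pi>: "conj_by \<theta> \<pi> = \<pi>" by (rule conj_by_eqI[OF b])
  have img: "\<theta> ` ({1..r} \<union> B) = {1..r} \<union> B'"
    using \<theta>(2) fix_r by (auto simp: image_Un)
  have p: "conj_by \<theta> \<sigma> permutes {1..r} \<union> B'" if "\<sigma> permutes {1..r} \<union> B" for \<sigma>
    using conj_by_permutes[OF b that] img by simp
  have shape: "shape_of m (conj_by \<theta> \<sigma>) (core m (conj_by \<theta> \<sigma>)) = shape_of m \<sigma> (core m \<sigma>)"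
    if "\<sigma> permutes {1..r} \<union> B" for \<sigma>
  proof -
    have "permutation \<sigma>" using that by (rule permutes_permutation) (simp add: assms(3))
    then show ?thesis
      using shape_of_conj[OF _ b fix_m conj_by_comp[OF b]] core_conj[OF b fix_m conj_by_comp[OF b]]
      by simp
  qed
  show ?thesis
  proof (rule card_inj_on_le[OF _ _ finite_local_factorisations[OF assms(4)]])
    let ?g = "map_prod (conj_by \<theta>) (conj_by \<theta>)"
    show "inj_on ?g (local_factorisations m r lam \<delta> \<pi> B)"
      by (auto simp: inj_on_def conj_by_inject[OF b])
    have "conj_by \<theta> \<sigma> y \<noteq> y" if "\<forall>x\<in>B. \<sigma> x \<noteq> x" "y \<in> B'" for \<sigma> y
    proof -
      obtain x where "x \<in> B" "y = \<theta> x" using \<theta>(2) \<open>y \<in> B'\<close> by blast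
      then show ?thesis
        using that(1) permutes_inj[OF \<theta>(1)] by (simp add: conj_by_apply[OF b] inj_eq)
    qed
    then show "?g ` local_factorisations m r lam \<delta> \<pi> B \<subseteq> local_factorisations m r lam \<delta> \<pi> B'"
      using p shape conj_\<pi> by (auto simp: local_factorisations_def conj_by_mult[OF b])
  qed
qed

lemma card_local_factorisations_cong:
  assumes "\<pi> permutes {1..r}" "m \<le> r" "finite B" "finite B'" "B \<inter> {1..r} = {}" "B' \<inter> {1..r} = {}"
    "card B = card B'"
  shows "card (local_factorisations m r lam \<delta> \<pi> B) = card (local_factorisations m r lam \<delta> \<pi> B')"
  using card_local_factorisations_le[OF assms]
    card_local_factorisations_le[OF assms(1,2,4,3,6,5) assms(7)[symmetric]]
  by (rule antisym)

lemma local_factorisations_bound: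
  assumes "core m \<pi> = {1..r}" "finite B" "B \<inter> {1..r} = {}"
    and "local_factorisations m r lam \<delta> \<pi> B \<noteq> {}"
  shows "2 * card B + r \<le> shape_size m lam + shape_size m \<delta>"
proof -
  obtain \<sigma> \<tau> where *: "\<sigma> permutes {1..r} \<union> B" "\<tau> permutes {1..r} \<union> B" "\<sigma> \<circ> \<tau> = \<pi>"
    "shape_of m \<sigma> (core m \<sigma>) = lam" "shape_of m \<tau> (core m \<tau>) = \<delta>" "\<forall>x\<in>B. \<sigma> x \<noteq> x"
    using assms(4) by (auto simp: local_factorisations_def)
  have p: "permutation \<sigma>" "permutation \<tau>"
    using *(1,2) assms(2) by (auto intro: permutes_permutation)
  have size: "shape_size m lam = card (core m \<sigma>)" "shape_size m \<delta> = card (core m \<tau>)"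
    using shape_size_core[OF p(1)] shape_size_core[OF p(2)] *(4,5) by auto
  have \<pi>: "\<pi> x = \<sigma> (\<tau> x)" for x using *(3) by auto
  have \<pi>B: "\<pi> x = x" if "x \<in> B" for x
    using that assms(1,3) by (auto simp: core_def)
  \<comment> \<open>If \<tau> fixed a point \<open>x\<close> of \<open>B\<close>, then
    \<open>\<sigma> x = \<pi> x = x\<close>, contrary to the choice of \<open>B\<close>.\<close>
  have "B \<subseteq> core m \<sigma> \<inter> core m \<tau>"
    using *(6) \<pi>B by (force simp: core_def \<pi>)
  \<comment> \<open>A point fixed by both factors is fixed by \<pi>.\<close>
  moreover have "{1..r} \<subseteq> core m \<sigma> \<union> core m \<tau>"
    unfolding assms(1)[symmetric] by (auto simp: core_def \<pi>)
  ultimately have "card B \<le> card (core m \<sigma> \<inter> core m \<tau>)"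
    "card ({1..r} \<union> B) \<le> card (core m \<sigma> \<union> core m \<tau>)"
    using finite_core[OF p(1)] finite_core[OF p(2)] by (auto intro!: card_mono)
  moreover have "card ({1..r} \<union> B) = r + card B"
    using assms(2,3) by (subst card_Un_disjoint) auto
  ultimately show ?thesis
    using card_Un_Int[OF finite_core[OF p(1)] finite_core[OF p(2)], of m m] size by linarith
qed

text \<open>Factorisations are sorted by the set of points beyond \<open>r\<close> that \<sigma>
  moves. For other points beyond \<open>r\<close>,
  \<open>\<sigma> (\<tau> x) = x = \<sigma> x\<close>, so injectivity makes \<tau> fix them
  too.\<close>

lemma factorisations_eq_Union:
  assumes "m \<le> r" "r \<le> n" "\<pi> permutes {1..r}"
    and "proper_shape lam" "shape_size m lam \<le> n" "proper_shape \<delta>" "shape_size m \<delta> \<le> n"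
  shows "factorisations m n (pad_shape m n lam) (pad_shape m n \<delta>) \<pi> =
    (\<Union>B\<in>Pow {r+1..n}. local_factorisations m r lam \<delta> \<pi> B)"
proof (intro Set.equalityI subsetI)
  have mn: "m \<le> n" using assms by simp
  fix p assume "p \<in> factorisations m n (pad_shape m n lam) (pad_shape m n \<delta>) \<pi>"
  then obtain \<sigma> \<tau> where p: "p = (\<sigma>, \<tau>)" "\<sigma> permutes {1..n}" "\<tau> permutes {1..n}" "\<sigma> \<circ> \<tau> = \<pi>"
    "marked_cycle_type m n \<sigma> = pad_shape m n lam" "marked_cycle_type m n \<tau> = pad_shape m n \<delta>"
    by (auto simp: factorisations_def)
  let ?B = "{x \<in> {r+1..n}. \<sigma> x \<noteq> x}"
  have \<sigma>: "\<sigma> x = x" if "x \<in> {1..n} - ({1..r} \<union> ?B)" for x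
    using that by auto
  have "\<tau> x = x" if "x \<in> {1..n} - ({1..r} \<union> ?B)" for x
  proof -
    have "\<pi> x = x" using that assms(3) by (auto intro: permutes_not_in)
    then have "\<sigma> (\<tau> x) = \<sigma> x" using \<sigma>[OF that] p(4) by auto
    then show ?thesis using permutes_inj[OF p(2)] by (metis injD)
  qed
  then have "\<sigma> permutes {1..r} \<union> ?B" "\<tau> permutes {1..r} \<union> ?B"
    using permutes_superset[OF p(2) \<sigma>] permutes_superset[OF p(3)] by blast+
  then have "p \<in> local_factorisations m r lam \<delta> \<pi> ?B"
    using p marked_cycle_type_eq_pad_iff[OF p(2) mn assms(4,5)]
      marked_cycle_type_eq_pad_iff[OF p(3) mn assms(6,7)]
    by (auto simp: local_factorisations_def)
  then show "p \<in> (\<Union>B\<in>Pow {r+1..n}. local_factorisations m r lam \<delta> \<pi> B)"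
    by (rule UN_I[rotated]) auto
next
  have mn: "m \<le> n" using assms by simp
  fix p assume "p \<in> (\<Union>B\<in>Pow {r+1..n}. local_factorisations m r lam \<delta> \<pi> B)"
  then obtain B \<sigma> \<tau> where p: "B \<subseteq> {r+1..n}" "p = (\<sigma>, \<tau>)" "\<sigma> permutes {1..r} \<union> B"
    "\<tau> permutes {1..r} \<union> B" "\<sigma> \<circ> \<tau> = \<pi>"
    "shape_of m \<sigma> (core m \<sigma>) = lam" "shape_of m \<tau> (core m \<tau>) = \<delta>"
    by (auto simp: local_factorisations_def)
  have "{1..r} \<union> B \<subseteq> {1..n}" using p(1) assms(2) by auto
  then have *: "\<sigma> permutes {1..n}" "\<tau> permutes {1..n}" using p(3,4) permutes_subset by blast+
  show "p \<in> factorisations m n (pad_shape m n lam) (pad_shape m n \<delta>) \<pi>"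
    using p(2,5-7) * marked_cycle_type_eq_pad_iff[OF *(1) mn assms(4,5)]
      marked_cycle_type_eq_pad_iff[OF *(2) mn assms(6,7)]
    by (simp add: factorisations_def)
qed

lemma sum_Pow_card:
  fixes g :: "nat \<Rightarrow> nat"
  assumes "finite S"
  shows "(\<Sum>B\<in>Pow S. g (card B)) = (\<Sum>j\<le>card S. (card S choose j) * g j)"
proof -
  have "card ` Pow S \<subseteq> {..card S}" using assms by (auto intro: card_mono)
  then have "(\<Sum>B\<in>Pow S. g (card B)) = (\<Sum>j\<le>card S. \<Sum>B\<in>{B \<in> Pow S. card B = j}. g (card B))"
    using assms by (intro sum.group[symmetric]) auto
  also have "\<dots> = (\<Sum>j\<le>card S. (card S choose j) * g j)"
    using assms by (intro sum.cong refl) (simp add: n_subsets)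
  finally show ?thesis .
qed

text \<open>The union over \<open>B\<close> is disjoint because \<sigma> determines
  \<open>B\<close>. Each \<open>B\<close> is then replaced by the initial block
  \<open>{r+1..r+j}\<close> of the same size, so that \<open>n\<close> survives only in the binomial
  coefficient.\<close>

lemma card_factorisations_eq_sum:
  assumes "m \<le> r" "r \<le> n" "\<pi> permutes {1..r}" "core m \<pi> = {1..r}"
    and "proper_shape lam" "shape_size m lam \<le> n" "proper_shape \<delta>" "shape_size m \<delta> \<le> n"
  shows "card (factorisations m n (pad_shape m n lam) (pad_shape m n \<delta>) \<pi>) =
    (\<Sum>j | 2 * j + r \<le> shape_size m lam + shape_size m \<delta>.
      ((n - r) choose j) * card (local_factorisations m r lam \<delta> \<pi> {r+1..r+j}))"
proof -
  let ?F = "local_factorisations m r lam \<delta> \<pi>"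
  let ?J = "{j. 2 * j + r \<le> shape_size m lam + shape_size m \<delta>}"
  have moved: "B = {x \<in> {r+1..n}. \<sigma> x \<noteq> x}"
    if F: "(\<sigma>, \<tau>) \<in> ?F B" and B: "B \<subseteq> {r+1..n}" for B \<sigma> \<tau>
  proof -
    have \<sigma>: "\<sigma> permutes {1..r} \<union> B" "\<forall>x\<in>B. \<sigma> x \<noteq> x"
      using F by (auto simp: local_factorisations_def)
    have "x \<in> B" if "x \<in> {r+1..n}" "\<sigma> x \<noteq> x" for x
      using permutes_not_in[OF \<sigma>(1), of x] that by auto
    then show ?thesis using \<sigma>(2) B by blast
  qed
  have "?F B \<inter> ?F B' = {}" if B: "B \<subseteq> {r+1..n}" "B' \<subseteq> {r+1..n}" "B \<noteq> B'" for B B'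
  proof (rule ccontr)
    assume "?F B \<inter> ?F B' \<noteq> {}"
    then obtain q where "q \<in> ?F B" "q \<in> ?F B'" by blast
    then have q: "(fst q, snd q) \<in> ?F B" "(fst q, snd q) \<in> ?F B'" by simp_all
    have "B = B'" by (rule trans[OF moved[OF q(1) B(1)] moved[OF q(2) B(2), symmetric]])
    with B(3) show False by (rule notE)
  qed
  then have "card (\<Union>B\<in>Pow {r+1..n}. ?F B) = (\<Sum>B\<in>Pow {r+1..n}. card (?F B))"
    by (intro card_UN_disjoint)
      (simp_all add: finite_local_factorisations finite_subset[OF _ finite_atLeastAtMost])
  also have "\<dots> = (\<Sum>B\<in>Pow {r+1..n}. card (?F {r+1..r+card B}))"
  proof (intro sum.cong refl)
    fix B assume "B \<in> Pow {r+1..n}"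
    then have "B \<subseteq> {r+1..n}" by simp
    then have "finite B" "B \<inter> {1..r} = {}" by (auto intro: finite_subset)
    then show "card (?F B) = card (?F {r+1..r+card B})"
      by (intro card_local_factorisations_cong[OF assms(3,1)]) auto
  qed
  also have "\<dots> = (\<Sum>j\<le>n-r. ((n - r) choose j) * card (?F {r+1..r+j}))"
    using sum_Pow_card[of "{r+1..n}" "\<lambda>j. card (?F {r+1..r+j})"] by simp
  \<comment> \<open>The index range becomes independent of \<open>n\<close>: indices above
    \<open>n - r\<close> have a zero binomial coefficient, and indices outside \<open>?J\<close>
    have no local factorisations by the core bound.\<close>
  also have "\<dots> = (\<Sum>j\<in>?J. ((n - r) choose j) * card (?F {r+1..r+j}))"
  proof (rule sum.mono_neutral_cong)
    show "finite ?J" by (rule finite_subset[of _ "{..shape_size m lam + shape_size m \<delta>}"]) auto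
    fix j assume "j \<in> {..n-r} - ?J"
    then have "?F {r+1..r+j} = {}"
      using local_factorisations_bound[OF assms(4), of "{r+1..r+j}" lam \<delta>] by fastforce
    then show "((n - r) choose j) * card (?F {r+1..r+j}) = 0" by simp
  qed auto
  finally show ?thesis
    using factorisations_eq_Union[OF assms(1-3,5-8)] by simp
qed

text \<open>This is the binomial coefficient of \<open>x - r\<close> over \<open>j\<close>, as a
  polynomial in \<open>x\<close>.\<close>

definition shifted_binomial_poly :: "nat \<Rightarrow> nat \<Rightarrow> rat poly" where
  "shifted_binomial_poly r j = smult (1 / fact j) (\<Prod>i<j. [:- of_nat (r + i), 1:])"

lemma degree_shifted_binomial_poly: "degree (shifted_binomial_poly r j) \<le> j"
proof -
  have "degree (\<Prod>i<j. [:- of_nat (r + i), 1 :: rat:]) \<le> (\<Sum>i<j. 1)"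
    using degree_prod_sum_le[of "{..<j}" "\<lambda>i. [:- of_nat (r + i), 1 :: rat:]"] by simp
  then show ?thesis
    unfolding shifted_binomial_poly_def using degree_smult_le
    by (metis card_lessThan le_trans sum_constant mult.right_neutral of_nat_id)
qed

lemma poly_shifted_binomial_poly:
  assumes "r \<le> n"
  shows "poly (shifted_binomial_poly r j) (of_nat n) = of_nat ((n - r) choose j)"
proof -
  have "(\<Prod>i<j. poly [:- of_nat (r + i), 1:] (of_nat n)) = (\<Prod>i = 0..<j. of_nat (n - r) - of_nat i :: rat)"
    using assms by (intro prod.cong) (auto simp: of_nat_diff)
  then show ?thesis
    by (simp add: shifted_binomial_poly_def poly_prod binomial_gbinomial gbinomial_prod_rev
        del: poly_pCons of_nat_add)
qed

text \<open>Two such polynomials agree at all large integers, so their difference would have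
  infinitely many roots.\<close>

lemma is_structure_poly_unique:
  assumes "is_structure_poly m lam \<delta> \<rho> p" "is_structure_poly m lam \<delta> \<rho> q"
  shows "p = q"
proof (rule ccontr)
  assume "p \<noteq> q"
  then have fin: "finite {x. poly (p - q) x = 0}" by (intro poly_roots_finite) simp
  let ?k = "m + shape_size m lam + shape_size m \<delta> + shape_size m \<rho>"
  have "poly (p - q) (of_nat n) = 0" if "n \<ge> ?k" for n
    using assms that by (simp add: is_structure_poly_def)
  then have "of_nat ` {?k..} \<subseteq> {x. poly (p - q) x = 0}" by auto
  then have "finite (of_nat ` {?k..} :: rat set)" using fin finite_subset by blast
  then show False
    by (simp add: finite_image_iff inj_on_def infinite_Ici)
qed

theorem corollary0p13:
  fixes m :: nat and lam \<delta> \<rho> :: shape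
  assumes "marked_cycle_shape m lam" and "proper_shape lam"
    and "marked_cycle_shape m \<delta>" and "proper_shape \<delta>"
    and "marked_cycle_shape m \<rho>" and "proper_shape \<rho>"
  shows "(\<exists>!p. is_structure_poly m lam \<delta> \<rho> p) \<and>
    poly_deg (structure_poly m lam \<delta> \<rho>)
      \<le> ereal ((real (shape_size m lam) + real (shape_size m \<delta>) - real (shape_size m \<rho>)) / 2)"
proof -
  define r where "r = shape_size m \<rho>"
  define J where "J = {j. 2 * j + r \<le> shape_size m lam + shape_size m \<delta>}"
  have mr: "m \<le> r" by (simp add: r_def shape_size_def)
  have "\<rho> \<in> marked_shapes m r" using assms(5) by (simp add: marked_shapes_def r_def)
  then obtain \<pi> where \<pi>: "\<pi> permutes {1..r}" "marked_cycle_type m r \<pi> = \<rho>"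
    by (rule marked_shape_realised)
  have perm: "permutation \<pi>" using \<pi>(1) by (rule permutes_permutation) simp
  \<comment> \<open>At \<open>n = r\<close> no padding occurs, so the criterion for padded types
    gives the shape of the core itself.\<close>
  have "\<rho> = pad_shape m r \<rho>" by (simp add: pad_shape_def r_def)
  then have shape: "shape_of m \<pi> (core m \<pi>) = \<rho>"
    using marked_cycle_type_eq_pad_iff[OF \<pi>(1) mr assms(6)] \<pi>(2) by (simp add: r_def)
  then have "card (core m \<pi>) = card {1..r}"
    using shape_size_core[OF perm, of m] by (simp add: r_def)
  then have core: "core m \<pi> = {1..r}"
    using core_subset[OF \<pi>(1) mr] by (intro card_subset_eq) auto
  define N where "N j = card (local_factorisations m r lam \<delta> \<pi> {r+1..r+j})" for j
  \<comment> \<open>Neither \<open>J\<close> nor \<open>N\<close> depends on \<open>n\<close>, so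
    one polynomial serves for all \<open>n\<close>.\<close>
  define p where "p = (\<Sum>j\<in>J. smult (of_nat (N j)) (shifted_binomial_poly r j))"
  have p: "is_structure_poly m lam \<delta> \<rho> p"
    unfolding is_structure_poly_def
  proof (intro allI impI, elim conjE)
    fix n assume n: "m \<le> n" "shape_size m lam \<le> n" "shape_size m \<delta> \<le> n" "shape_size m \<rho> \<le> n"
    then have rn: "r \<le> n" by (simp add: r_def)
    then have perm_n: "\<pi> permutes {1..n}" using permutes_subset[OF \<pi>(1)] by simp
    then have "marked_cycle_type m n \<pi> = pad_shape m n \<rho>"
      using marked_cycle_type_eq_pad_iff[OF _ n(1) assms(6) n(4)] shape by blast
    then have "structure_coeff m n (pad_shape m n lam) (pad_shape m n \<delta>) (pad_shape m n \<rho>) =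
        int (\<Sum>j\<in>J. ((n - r) choose j) * N j)"
      using structure_coeff_eq_card[OF perm_n n(1), of "pad_shape m n lam" "pad_shape m n \<delta>"]
        card_factorisations_eq_sum[OF mr rn \<pi>(1) core assms(2) n(2) assms(4) n(3)]
      by (simp add: J_def N_def)
    then show "of_int (structure_coeff m n (pad_shape m n lam) (pad_shape m n \<delta>) (pad_shape m n \<rho>)) =
        poly p (of_nat n)"
      by (simp add: p_def poly_sum poly_shifted_binomial_poly[OF rn] mult.commute)
  qed
  have "structure_poly m lam \<delta> \<rho> = p"
    unfolding structure_poly_def using p is_structure_poly_unique by blast
  moreover have "poly_deg p \<le> ereal ((real (shape_size m lam) + real (shape_size m \<delta>) - real r) / 2)"
  proof (cases "p = 0")
    case False
    \<comment> \<open>A nonempty \<open>J\<close> gives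
      \<open>r \<le> shape_size m lam + shape_size m \<delta>\<close>, so the natural-number
      subtraction in the degree bound does not truncate.\<close>
    then obtain j where "j \<in> J" unfolding p_def by (metis all_not_in_conv sum.empty)
    have "finite J" unfolding J_def
      by (rule finite_subset[of _ "{..shape_size m lam + shape_size m \<delta>}"]) auto
    then have "degree p \<le> (shape_size m lam + shape_size m \<delta> - r) div 2"
      unfolding p_def
    proof (rule degree_sum_le)
      fix j assume "j \<in> J"
      then have "j \<le> (shape_size m lam + shape_size m \<delta> - r) div 2" by (simp add: J_def)
      then show "degree (smult (of_nat (N j)) (shifted_binomial_poly r j)) \<le>
          (shape_size m lam + shape_size m \<delta> - r) div 2"
        using degree_smult_le[of "of_nat (N j)" "shifted_binomial_poly r j"]
          degree_shifted_binomial_poly[of r j] by linarith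
    qed
    then have "2 * degree p + r \<le> shape_size m lam + shape_size m \<delta>"
      using \<open>j \<in> J\<close> by (simp add: J_def)
    with False show ?thesis by (simp add: poly_deg_def)
  qed (simp add: poly_deg_def)
  ultimately show ?thesis using p is_structure_poly_unique by (auto simp: r_def)
qed

end
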